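(* Let $G$ be a finitely generated nilpotent group and let $d_1,\dots,d_n$ be integers and $(c_{ik})$ an $n\times n$ integer matrix with $\gcd(d_1\cdots d_n,\ e_1\cdots e_n)=1$ and $\det(c_{ik})=1$. Then $\mathrm{Abdef}(G,\bar d,\bar c)\equiv G$.
   Context: For a subgroup $N$ of a group $G$, the isolator is $Is(N)=\{x\in G:\ x^k\in N\text{ for some integer }k\ge 1\}$. Let $G$ be a finitely generated nilpotent group, $I(G)=Is(G')\cap Z(G)$. An addition of $G$ is a subgroup $G_0\le Z(G)$ with $Z(G)=G_0\times I(G)$; additions exist and are free abelian of finite rank $p$. Fix an addition $G_0$. Put $N(G)=Is(G')\cdot Z(G)=Is(G')\times G_0$, $M(G)=Is(G'\cdot Z(G))$ and $\bar G=G/N(G)$ (abelian); $M(G)/N(G)$ is finite. View $G$ as an extension $1\to N(G)\to G\to \bar G\to 1$ with coupling $\chi:\bar G\to \mathrm{Out}(N(G))$; such extensions with coupling $\chi$ correspond bijectively to $H^2(\bar G,Z(N(G)))\cong H^2(\bar G,N_1(G))\oplus \mathrm{Ext}(M(G)/N(G),G_0)$, where $N_1(G)=Z(Is(G'))$ and $Z(N(G))=N_1(G)\times G_0$ as $\bar G$-modules; write the class of $G$ as $[f_1]\oplus[f_2]$. Choose $u_1,\dots,u_n\in M(G)$ with $M(G)/N(G)=\bigoplus_{i}\langle u_iN(G)\rangle$ its invariant factor decomposition, orders $e_1\mid\cdots\mid e_n$, $e_i>1$, and a basis $z_1,\dots,z_p$ of $G_0$ ($n\le p$) with $u_i^{e_i}\in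 z_iIs(G')$ for $i\le n$. Let $f_2'=\sum_{i=1}^n f'_{2i}$, where for $0\le s,t<e_i$, $f'_{2i}(u_i^sN(G),u_i^tN(G))=1$ if $s+t<e_i$ and $=\prod_{k=1}^n z_k^{d_kc_{ik}}$ if $s+t\ge e_i$. $\mathrm{Abdef}(G,\bar d,\bar c)$ is the extension of $N(G)$ by $\bar G$ with coupling $\chi$ corresponding to the class $[f_1]\oplus[f_2']$. *)

theory Defs
  imports "HOL-Algebra.Algebra" "HOL-Combinatorics.Permutations"
begin

definition fin_gen_group :: "('a, 'b) monoid_scheme \<Rightarrow> bool" where
  "fin_gen_group G \<longleftrightarrow> group G \<and>
     (\<exists>S. finite S \<and> S \<subseteq> carrier G \<and> generate G S = carrier G)"

definition comm_set :: "('a, 'b) monoid_scheme \<Rightarrow> 'a set \<Rightarrow> 'a set \<Rightarrow> 'a set" where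
  "comm_set G A B = (\<Union>a\<in>A. \<Union>b\<in>B. {a \<otimes>\<^bsub>G\<^esub> b \<otimes>\<^bsub>G\<^esub> inv\<^bsub>G\<^esub> a \<otimes>\<^bsub>G\<^esub> inv\<^bsub>G\<^esub> b})"

text \<open>Lower central series: gamma_1 = G, gamma_(k+1) = [G, gamma_k] (shifted to start at 0).\<close>
fun lower_central :: "('a, 'b) monoid_scheme \<Rightarrow> nat \<Rightarrow> 'a set" where
  "lower_central G 0 = carrier G"
| "lower_central G (Suc k) = generate G (comm_set G (carrier G) (lower_central G k))"

definition nilpotent_group :: "('a, 'b) monoid_scheme \<Rightarrow> bool" where
  "nilpotent_group G \<longleftrightarrow> group G \<and> (\<exists>k. lower_central G k = {\<one>\<^bsub>G\<^esub>})"

definition center :: "('a, 'b) monoid_scheme \<Rightarrow> 'a set" where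
  "center G = {z \<in> carrier G. \<forall>x \<in> carrier G. z \<otimes>\<^bsub>G\<^esub> x = x \<otimes>\<^bsub>G\<^esub> z}"

definition isolator :: "('a, 'b) monoid_scheme \<Rightarrow> 'a set \<Rightarrow> 'a set" where
  "isolator G N = {x \<in> carrier G. \<exists>k::nat. k \<ge> 1 \<and> x [^]\<^bsub>G\<^esub> k \<in> N}"

abbreviation comm_subgroup :: "('a, 'b) monoid_scheme \<Rightarrow> 'a set" where
  "comm_subgroup G \<equiv> derived G (carrier G)"

definition IG :: "('a, 'b) monoid_scheme \<Rightarrow> 'a set" where
  "IG G = isolator G (comm_subgroup G) \<inter> center G"

definition addition :: "('a, 'b) monoid_scheme \<Rightarrow> 'a set \<Rightarrow> bool" where
  "addition G G0 \<longleftrightarrow> subgroup G0 G \<and> G0 \<subseteq> center G \<and>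
     G0 \<inter> IG G = {\<one>\<^bsub>G\<^esub>} \<and> G0 <#>\<^bsub>G\<^esub> IG G = center G"

definition NG :: "('a, 'b) monoid_scheme \<Rightarrow> 'a set" where
  "NG G = isolator G (comm_subgroup G) <#>\<^bsub>G\<^esub> center G"

definition MG :: "('a, 'b) monoid_scheme \<Rightarrow> 'a set" where
  "MG G = isolator G (comm_subgroup G <#>\<^bsub>G\<^esub> center G)"

definition gprod :: "('a, 'b) monoid_scheme \<Rightarrow> (nat \<Rightarrow> 'a) \<Rightarrow> nat \<Rightarrow> 'a" where
  "gprod G x m = foldr (\<lambda>i acc. x i \<otimes>\<^bsub>G\<^esub> acc) [0..<m] \<one>\<^bsub>G\<^esub>"

definition exp_box :: "(nat \<Rightarrow> nat) \<Rightarrow> nat \<Rightarrow> (nat \<Rightarrow> nat) set" where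
  "exp_box e n = {s. (\<forall>i<n. s i < e i) \<and> (\<forall>i\<ge>n. s i = 0)}"

definition det_int :: "nat \<Rightarrow> (nat \<Rightarrow> nat \<Rightarrow> int) \<Rightarrow> int" where
  "det_int n c = (\<Sum>p | p permutes {..<n}. sign p * (\<Prod>i<n. c i (p i)))"

text \<open>Torsion coordinates of x: given a complement Fc/N(G) of M(G)/N(G) in G/N(G),
  the unique s in the box with x \<in> Fc \<cdot> u_0^(s_0) ... u_(n-1)^(s_(n-1)).\<close>
definition tcoord :: "('a, 'b) monoid_scheme \<Rightarrow> 'a set \<Rightarrow> (nat \<Rightarrow> 'a) \<Rightarrow> (nat \<Rightarrow> nat)
                      \<Rightarrow> nat \<Rightarrow> 'a \<Rightarrow> (nat \<Rightarrow> nat)" where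
  "tcoord G Fc u e n x =
     (THE s. s \<in> exp_box e n \<and> x \<in> Fc #>\<^bsub>G\<^esub> gprod G (\<lambda>i. u i [^]\<^bsub>G\<^esub> s i) n)"

text \<open>The central 2-cocycle f_2' - f_2 (values in G0), as a function of elements of G
  (it only depends on their images in G/N(G)).\<close>
definition abdef_delta ::
  "('a, 'b) monoid_scheme \<Rightarrow> 'a set \<Rightarrow> (nat \<Rightarrow> 'a) \<Rightarrow> (nat \<Rightarrow> nat) \<Rightarrow> nat \<Rightarrow> (nat \<Rightarrow> 'a)
   \<Rightarrow> (nat \<Rightarrow> int) \<Rightarrow> (nat \<Rightarrow> nat \<Rightarrow> int) \<Rightarrow> 'a \<Rightarrow> 'a \<Rightarrow> 'a" where
  "abdef_delta G Fc u e n z d c x y =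
     (let s = tcoord G Fc u e n x; t = tcoord G Fc u e n y in
      gprod G (\<lambda>i. if s i + t i \<ge> e i
                    then gprod G (\<lambda>k. z k [^]\<^bsub>G\<^esub> (d k * c i k)) n \<otimes>\<^bsub>G\<^esub> inv\<^bsub>G\<^esub> z i
                    else \<one>\<^bsub>G\<^esub>) n)"

text \<open>Abdef(G,d,c): the extension of N(G) by G/N(G) with the same coupling and with
  cohomology class [f_1] + [f_2'], realised on the set carrier G by twisting the
  multiplication of G with the central cocycle f_2' - f_2.\<close>
definition Abdef ::
  "('a, 'b) monoid_scheme \<Rightarrow> 'a set \<Rightarrow> (nat \<Rightarrow> 'a) \<Rightarrow> (nat \<Rightarrow> nat) \<Rightarrow> nat \<Rightarrow> (nat \<Rightarrow> 'a)
   \<Rightarrow> (nat \<Rightarrow> int) \<Rightarrow> (nat \<Rightarrow> nat \<Rightarrow> int) \<Rightarrow> 'a monoid" where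
  "Abdef G Fc u e n z d c =
     \<lparr>carrier = carrier G,
      monoid.mult = (\<lambda>x y. x \<otimes>\<^bsub>G\<^esub> y \<otimes>\<^bsub>G\<^esub> abdef_delta G Fc u e n z d c x y),
      monoid.one = \<one>\<^bsub>G\<^esub>\<rparr>"

datatype gterm = GVar nat | GOne | GMul gterm gterm | GInv gterm

datatype gform = GEq gterm gterm | GNot gform | GAnd gform gform | GEx nat gform

fun tvars :: "gterm \<Rightarrow> nat set" where
  "tvars (GVar v) = {v}"
| "tvars GOne = {}"
| "tvars (GMul s t) = tvars s \<union> tvars t"
| "tvars (GInv t) = tvars t"

fun fvars :: "gform \<Rightarrow> nat set" where
  "fvars (GEq s t) = tvars s \<union> tvars t"
| "fvars (GNot f) = fvars f"
| "fvars (GAnd f g) = fvars f \<union> fvars g"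
| "fvars (GEx v f) = fvars f - {v}"

fun teval :: "('a, 'b) monoid_scheme \<Rightarrow> (nat \<Rightarrow> 'a) \<Rightarrow> gterm \<Rightarrow> 'a" where
  "teval G env (GVar v) = env v"
| "teval G env GOne = \<one>\<^bsub>G\<^esub>"
| "teval G env (GMul s t) = teval G env s \<otimes>\<^bsub>G\<^esub> teval G env t"
| "teval G env (GInv t) = inv\<^bsub>G\<^esub> (teval G env t)"

fun sat :: "('a, 'b) monoid_scheme \<Rightarrow> (nat \<Rightarrow> 'a) \<Rightarrow> gform \<Rightarrow> bool" where
  "sat G env (GEq s t) = (teval G env s = teval G env t)"
| "sat G env (GNot f) = (\<not> sat G env f)"
| "sat G env (GAnd f g) = (sat G env f \<and> sat G env g)"
| "sat G env (GEx v f) = (\<exists>a \<in> carrier G. sat G (env(v := a)) f)"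

definition models :: "('a, 'b) monoid_scheme \<Rightarrow> gform \<Rightarrow> bool" where
  "models G f \<longleftrightarrow> (\<forall>env. range env \<subseteq> carrier G \<longrightarrow> sat G env f)"

definition elem_equiv :: "('a, 'b) monoid_scheme \<Rightarrow> ('c, 'd) monoid_scheme \<Rightarrow> bool" where
  "elem_equiv G H \<longleftrightarrow> (\<forall>f. fvars f = {} \<longrightarrow> (models G f \<longleftrightarrow> models H f))"

end

theory Submission
  imports Defs "Jordan_Normal_Form.Determinant"
begin

text \<open>Proof idea. \<open>Fc\<close> splits as \<open>C \<times> G0\<close> with \<open>C \<supseteq> Is(G')\<close>, so \<open>G\<close> is the fibre product of \<open>G / G0\<close> and a
  lattice in \<open>\<int>\<^sup>p\<close> over the finite group \<open>M(G)/N(G)\<close>. Twisting the multiplication by a cocycle with values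
  in \<open>G0\<close> keeps \<open>G / G0\<close> and replaces the lattice \<open>L\<close> by another lattice \<open>L'\<close>. The hypotheses on \<open>d\<close> and
  \<open>c\<close> give, for every modulus \<open>N\<close>, an integer matrix that is invertible modulo \<open>N\<close> and compatible with
  the maps of \<open>L\<close> and \<open>L'\<close> to the finite group. An Ehrenfeucht--Fraisse game then shows elementary equivalence:
  the second player answers in the same coset of \<open>G0\<close>, keeps the lattice coordinates congruent modulo
  \<open>N\<close>, and preserves all linear relations with coefficients up to \<open>K\<close>, where \<open>N\<close> and \<open>K\<close>
  shrink with each quantifier.\<close>

section \<open>The back-and-forth game on lattices\<close>

text \<open>The natural map between the lattices is \<open>twist n d c\<close>, which sends the
  coordinates of \<open>z i\<close> to those of the product of the
  \<open>z k [^] (d k * c i k)\<close>. Its determinant is the product of the \<open>d k\<close>,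
  which is prime to \<open>E = \<Prod> e i\<close> but possibly different from 1 and -1. It then
  fails to be onto, and a choice in \<open>H\<close> may have no exact counterpart in
  \<open>G\<close>. Two observations get around this. Compatibility with the finite group sees
  \<open>d\<close> only modulo \<open>E\<close>; so, for each sentence separately, \<open>d\<close>
  can be replaced by a congruent \<open>d'\<close> with entries prime to the modulus
  \<open>N\<close> of that sentence. And an answer need only be congruent to the image: if the new
  vector satisfies a bounded relation with coefficient \<open>l \<noteq> 0\<close>, the answer is
  forced and arises by dividing by \<open>l\<close>, which costs a factor \<open>l\<close> of the
  modulus and explains the factorials; otherwise it is pushed so far out that no bounded relation
  involves it. Eliminating the new vector from two relations of size \<open>K\<close> gives one of
  size \<open>2 * K^2\<close>.\<close>

lemma lin_dvd_diff:
  fixes B :: "(nat \<Rightarrow> int) \<Rightarrow> nat \<Rightarrow> int" and N :: int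
  assumes lin: "\<And>h x. \<And>J::nat set. B (\<lambda>k. \<Sum>v\<in>J. h v * x v k) = (\<lambda>k. \<Sum>v\<in>J. h v * B (x v) k)"
    and dvd: "\<And>k. N dvd x k - y k"
  shows "N dvd B x k - B y k"
proof -
  obtain q where q: "\<And>k. x k - y k = N * q k" using dvd unfolding dvd_def by metis
  \<comment> \<open>\<open>lin\<close> speaks of families only, so \<open>y + N * q\<close> is
    presented as a family indexed by \<open>{0, 1}\<close> with coefficients \<open>1\<close> and
    \<open>N\<close>.\<close>
  define c where "c v = (if v = 0 then 1 else N)" for v :: nat
  define f where "f v = (if v = 0 then y else q)" for v :: nat
  have x: "x = (\<lambda>k. \<Sum>v\<in>{0,1::nat}. c v * f v k)"
    using q by (auto simp: c_def f_def fun_eq_iff) (metis add.commute diff_add_cancel)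
  have "B x k = B y k + N * B q k"
    unfolding x lin by (simp add: c_def f_def)
  then show ?thesis by simp
qed

text \<open>A single answer in the game, on vectors alone. The old vector at \<open>v0\<close> is
  overwritten, so a nonzero coefficient there belongs to the new vector \<open>b\<close>. If a
  relation of size \<open>K\<close> with such a coefficient exists, it determines \<open>b'\<close>,
  and all relations of size \<open>K\<close> reduce to relations of size \<open>2 * K^2\<close>
  among the remaining vectors. If none exists, \<open>b'\<close> only has to avoid them.\<close>

lemma extend_approximation:
  fixes a a' :: "nat \<Rightarrow> nat \<Rightarrow> int" and b :: "nat \<Rightarrow> int"
    and B :: "(nat \<Rightarrow> int) \<Rightarrow> nat \<Rightarrow> int" and K N N1 :: int
  assumes supp': "\<And>v k. v < m \<Longrightarrow> k \<ge> p \<Longrightarrow> a' v k = 0"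
    and b: "\<And>k. k \<ge> p \<Longrightarrow> b k = 0" and Bb: "\<And>k. k \<ge> p \<Longrightarrow> B b k = 0"
    and lin: "\<And>h x. \<And>J::nat set. B (\<lambda>k. \<Sum>v\<in>J. h v * x v k) = (\<lambda>k. \<Sum>v\<in>J. h v * B (x v) k)"
    and cong: "\<And>v k. v < m \<Longrightarrow> N dvd a' v k - B (a v) k"
    and N: "N1 > 0" "\<And>l. l \<noteq> 0 \<Longrightarrow> \<bar>l\<bar> \<le> K \<Longrightarrow> l * N1 dvd N" and K: "K \<ge> 1" and v0: "v0 < m"
    and rel: "\<And>h. (\<And>v. \<bar>h v\<bar> \<le> 2 * K\<^sup>2) \<Longrightarrow>
        (\<forall>k. (\<Sum>v<m. h v * a v k) = 0) \<longleftrightarrow> (\<forall>k. (\<Sum>v<m. h v * a' v k) = 0)"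
  shows "\<exists>b'. (\<forall>k\<ge>p. b' k = 0) \<and> (\<forall>k. N1 dvd b' k - B b k) \<and>
     (\<forall>h. (\<forall>v. \<bar>h v\<bar> \<le> K) \<longrightarrow>
       (\<forall>k. (\<Sum>v<m. h v * (a(v0 := b)) v k) = 0) \<longleftrightarrow> (\<forall>k. (\<Sum>v<m. h v * (a'(v0 := b')) v k) = 0))"
proof -
  let ?J = "{..<m} - {v0}"
  have split: "(\<Sum>v<m. h v * (f(v0 := g)) v k) = h v0 * g k + (\<Sum>v\<in>?J. h v * f v k)"
    for h :: "nat \<Rightarrow> int" and f g k
    using v0 by (subst sum.remove[of _ v0]) (auto intro!: sum.cong)
  have rel0: "(\<forall>k. (\<Sum>v\<in>?J. h v * a v k) = 0) \<longleftrightarrow> (\<forall>k. (\<Sum>v\<in>?J. h v * a' v k) = 0)"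
    if h: "\<And>v. \<bar>h v\<bar> \<le> 2 * K\<^sup>2" for h
  proof -
    have *: "(\<Sum>v<m. (h(v0 := 0)) v * f v k) = (\<Sum>v\<in>?J. h v * f v k)" for f :: "nat \<Rightarrow> nat \<Rightarrow> int" and k
      using v0 by (subst sum.remove[of _ v0]) (auto intro!: sum.cong)
    have "\<And>v. \<bar>(h(v0 := 0)) v\<bar> \<le> 2 * K\<^sup>2" using h by (simp add: K)
    then show ?thesis using rel[of "h(v0 := 0)"] unfolding * by blast
  qed
  have KK: "\<bar>x\<bar> \<le> K \<Longrightarrow> \<bar>x\<bar> \<le> 2 * K\<^sup>2" for x
  proof -
    assume "\<bar>x\<bar> \<le> K"
    moreover have "K * 1 \<le> K * K" using K by (intro mult_left_mono) auto
    ultimately show ?thesis using K unfolding power2_eq_square by linarith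
  qed
  show ?thesis
  proof (cases "\<exists>h. (\<forall>v. \<bar>h v\<bar> \<le> K) \<and> h v0 \<noteq> 0 \<and> (\<forall>k. (\<Sum>v<m. h v * (a(v0 := b)) v k) = 0)")
    case True
    then obtain h where h': "\<forall>v. \<bar>h v\<bar> \<le> K" and l0: "h v0 \<noteq> 0"
      and h0': "\<forall>k. (\<Sum>v<m. h v * (a(v0 := b)) v k) = 0"
      by (elim exE conjE)
    have h: "\<bar>h v\<bar> \<le> K" for v using h' by simp
    have h0: "h v0 * b k + (\<Sum>v\<in>?J. h v * a v k) = 0" for k
      using h0' unfolding split by simp
    define l where "l = h v0"
    define s where "s k = (\<Sum>v\<in>?J. h v * a' v k)" for k
    have l: "l \<noteq> 0" "\<bar>l\<bar> \<le> K" using l0 h by (auto simp: l_def)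
    \<comment> \<open>The relation \<open>h\<close> is carried over by \<open>B\<close>. As
      \<open>a'\<close> agrees with \<open>B a\<close> modulo \<open>N\<close>, the same combination
      \<open>s\<close> of the \<open>a'\<close> is \<open>- l * B b\<close> modulo
      \<open>N\<close>.\<close>
    have Bs: "(\<Sum>v\<in>?J. h v * B (a v) k) = - l * B b k" for k
    proof -
      have "(\<lambda>k. \<Sum>v\<in>?J. h v * a v k) = (\<lambda>k. \<Sum>v\<in>{0::nat}. (- l) * b k)"
        using h0 by (auto simp: l_def fun_eq_iff) (metis add.commute add_eq_0_iff)
      then have "B (\<lambda>k. \<Sum>v\<in>?J. h v * a v k) = B (\<lambda>k. \<Sum>v\<in>{0::nat}. (- l) * b k)" by simp
      then show ?thesis unfolding lin[of h a] lin[of "\<lambda>_. -l" "\<lambda>_. b" "{0}"] by (simp add: fun_eq_iff)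
    qed
    have s: "N dvd s k + l * B b k" for k
    proof -
      have "N dvd (\<Sum>v\<in>?J. h v * (a' v k - B (a v) k))" using cong by (intro dvd_sum) auto
      also have "\<dots> = s k + l * B b k"
        using Bs by (simp add: s_def right_diff_distrib sum_subtractf)
      finally show ?thesis .
    qed
    have "l dvd s k" for k
      using s[of k] N(2)[OF l] by (metis dvd_add_left_iff dvd_mult_left dvd_trans dvd_triv_left)
    then obtain q where q: "\<And>k. s k = l * q k" unfolding dvd_def by metis
    \<comment> \<open>The only solution of \<open>l * b' + s = 0\<close>. Dividing a congruence
      modulo \<open>l * N1\<close> by \<open>l\<close> leaves one modulo \<open>N1\<close>.\<close>
    define b' where "b' k = - q k" for k
    have sb: "s k = - l * b' k" for k by (simp add: b'_def q)
    have "b' k = 0" if "k \<ge> p" for k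
    proof -
      have "s k = 0" unfolding s_def using that supp' by (intro sum.neutral) auto
      then show ?thesis using sb l by auto
    qed
    moreover have "N1 dvd b' k - B b k" for k
    proof -
      have "l * N1 dvd s k + l * B b k" using s N(2)[OF l] dvd_trans by blast
      also have "s k + l * B b k = l * - (b' k - B b k)" by (simp add: sb algebra_simps)
      finally show ?thesis using l by (metis dvd_minus_iff dvd_mult_cancel_left)
    qed
    moreover have "(\<forall>k. (\<Sum>v<m. h' v * (a(v0 := b)) v k) = 0) \<longleftrightarrow> (\<forall>k. (\<Sum>v<m. h' v * (a'(v0 := b')) v k) = 0)"
      if h': "\<forall>v. \<bar>h' v\<bar> \<le> K" for h'
    proof -
      \<comment> \<open>multiplying by \<open>l\<close> lets us eliminate the new vector\<close>
      let ?g = "\<lambda>v. l * h' v - h' v0 * h v"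
      have g: "\<bar>?g v\<bar> \<le> 2 * K\<^sup>2" for v
      proof -
        have "\<bar>?g v\<bar> \<le> \<bar>l\<bar> * \<bar>h' v\<bar> + \<bar>h' v0\<bar> * \<bar>h v\<bar>"
          by (metis abs_mult abs_triangle_ineq4)
        also have "\<dots> \<le> K * K + K * K" using l h h' K by (intro add_mono mult_mono) auto
        finally show ?thesis by (simp add: power2_eq_square)
      qed
      \<comment> \<open>\<open>l\<close> times the relation \<open>h'\<close> minus
        \<open>h' v0\<close> times the relation \<open>h\<close>, so that the coefficient at
        \<open>v0\<close> cancels. This applies to \<open>a\<close>, \<open>b\<close> and to
        \<open>a'\<close>, \<open>b'\<close> alike, and \<open>l \<noteq> 0\<close> makes it
        reversible.\<close>
      have ex: "l * (h' v0 * x + (\<Sum>v\<in>?J. h' v * f v k)) = (\<Sum>v\<in>?J. ?g v * f v k)"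
        if "l * x + (\<Sum>v\<in>?J. h v * f v k) = 0" for f :: "nat \<Rightarrow> nat \<Rightarrow> int" and x k
      proof -
        have "(\<Sum>v\<in>?J. ?g v * f v k) = l * (\<Sum>v\<in>?J. h' v * f v k) - h' v0 * (\<Sum>v\<in>?J. h v * f v k)"
          by (simp add: sum_distrib_left left_diff_distrib sum_subtractf mult.assoc)
        also have "(\<Sum>v\<in>?J. h v * f v k) = - l * x" using that by simp
        finally show ?thesis by (simp add: algebra_simps)
      qed
      have 1: "(h' v0 * b k + (\<Sum>v\<in>?J. h' v * a v k) = 0) \<longleftrightarrow> (\<Sum>v\<in>?J. ?g v * a v k) = 0" for k
        using ex[of "b k" a k, OF h0[of k, folded l_def], symmetric] l by simp
      have "l * b' k + (\<Sum>v\<in>?J. h v * a' v k) = 0" for k using sb[of k] by (simp add: s_def)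
      from ex[of "b' k" a' k for k, OF this, symmetric] l
      have 2: "(h' v0 * b' k + (\<Sum>v\<in>?J. h' v * a' v k) = 0) \<longleftrightarrow> (\<Sum>v\<in>?J. ?g v * a' v k) = 0" for k by simp
      show ?thesis unfolding split 1 2 using rel0[of ?g] g by blast
    qed
    ultimately show ?thesis by blast
  next
    case False
    \<comment> \<open>A coordinate \<open>0\<close> must exist to be shifted: for
      \<open>p = 0\<close> the vector \<open>b\<close> vanishes, and the relation with the single
      coefficient \<open>1\<close> at \<open>v0\<close> would hold.\<close>
    have p0: "0 < p"
    proof (rule ccontr)
      assume "\<not> 0 < p"
      then have "b = (\<lambda>k. 0)" using b by auto
      moreover define h where "h v = (if v = v0 then 1 else 0 :: int)" for v
      ultimately have "(\<Sum>v<m. h v * (a(v0 := b)) v k) = 0" for k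
        by (intro sum.neutral) auto
      moreover have "\<forall>v. \<bar>h v\<bar> \<le> K" "h v0 \<noteq> 0" using K by (auto simp: h_def)
      ultimately show False using False by blast
    qed
    \<comment> \<open>a large shift along the first coordinate avoids all bounded relations\<close>
    define R where "R = K * (\<Sum>v\<in>?J. \<bar>a' v 0\<bar>)"
    \<comment> \<open>\<open>R\<close> bounds the first coordinate of every combination of the other
      vectors with coefficients up to \<open>K\<close>. The term \<open>\<bar>B b 0\<bar>\<close>
      absorbs a negative \<open>B b 0\<close>, and \<open>1\<close> makes the inequality
      strict.\<close>
    define t where "t = \<bar>B b 0\<bar> + R + 1"
    have R0: "R \<ge> 0" using K by (auto simp: R_def intro!: mult_nonneg_nonneg sum_nonneg)
    define b' where "b' k = (if k = 0 then B b k + N1 * t else B b k)" for k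
    have big: "\<bar>b' 0\<bar> > R"
    proof -
      have "N1 * t \<ge> 1 * t" using N R0 by (intro mult_right_mono) (auto simp: t_def)
      then show ?thesis by (simp add: b'_def t_def)
    qed
    have A: "h' v0 = 0" if h': "\<forall>v. \<bar>h' v\<bar> \<le> K" and z: "\<forall>k. (\<Sum>v<m. h' v * (a'(v0 := b')) v k) = 0" for h'
    proof (rule ccontr)
      assume n: "h' v0 \<noteq> 0"
      have "h' v0 * b' 0 = - (\<Sum>v\<in>?J. h' v * a' v 0)" using z unfolding split by (metis eq_neg_iff_add_eq_0)
      then have "\<bar>h' v0\<bar> * \<bar>b' 0\<bar> = \<bar>\<Sum>v\<in>?J. h' v * a' v 0\<bar>" by (metis abs_minus_cancel abs_mult)
      also have "\<dots> \<le> (\<Sum>v\<in>?J. \<bar>h' v\<bar> * \<bar>a' v 0\<bar>)" by (metis (no_types, lifting) abs_mult sum.cong sum_abs)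
      also have "\<dots> \<le> R" unfolding R_def sum_distrib_left using h' by (intro sum_mono mult_right_mono) auto
      finally have "\<bar>h' v0\<bar> * \<bar>b' 0\<bar> \<le> R" by simp
      moreover have "1 * \<bar>b' 0\<bar> \<le> \<bar>h' v0\<bar> * \<bar>b' 0\<bar>" using n by (intro mult_right_mono) auto
      ultimately show False using big by simp
    qed
    have A': "h' v0 = 0" if "\<forall>v. \<bar>h' v\<bar> \<le> K" "\<forall>k. (\<Sum>v<m. h' v * (a(v0 := b)) v k) = 0" for h'
      using that False by blast
    have "(\<forall>k. (\<Sum>v<m. h v * (a(v0 := b)) v k) = 0) \<longleftrightarrow> (\<forall>k. (\<Sum>v<m. h v * (a'(v0 := b')) v k) = 0)"
      if h: "\<forall>v. \<bar>h v\<bar> \<le> K" for h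
    proof (cases "h v0 = 0")
      case True
      have "\<And>v. \<bar>h v\<bar> \<le> 2 * K\<^sup>2" using h KK by blast
      then show ?thesis unfolding split True using rel0[of h] by simp
    next
      case False
      then show ?thesis using A[OF h] A'[OF h] by blast
    qed
    moreover have "\<forall>k\<ge>p. b' k = 0" "\<forall>k. N1 dvd b' k - B b k" using p0 Bb by (auto simp: b'_def)
    ultimately show ?thesis by blast
  qed
qed


section \<open>Exponent sums of terms, and the game parameters attached to a formula\<close>

fun tcoef :: "gterm \<Rightarrow> nat \<Rightarrow> int" where
  "tcoef (GVar v) = (\<lambda>w. if w = v then 1 else 0)"
| "tcoef GOne = (\<lambda>w. 0)"
| "tcoef (GMul s t) = (\<lambda>w. tcoef s w + tcoef t w)"
| "tcoef (GInv t) = (\<lambda>w. - tcoef t w)"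

fun tweight :: "gterm \<Rightarrow> int" where
  "tweight (GVar v) = 1"
| "tweight GOne = 0"
| "tweight (GMul s t) = tweight s + tweight t"
| "tweight (GInv t) = tweight t"

text \<open>A homomorphism to an abelian group sees only exponent sums, and cancellation can only
  bring these below the number of occurrences.\<close>

lemma abs_tcoef_le: "\<bar>tcoef t v\<bar> \<le> tweight t"
  by (induction t) auto

text \<open>Bound variables are included because the game overwrites slots of an environment of
  fixed length \<open>m\<close>, and a quantified variable needs a slot below
  \<open>m\<close>.\<close>

fun allvars :: "gform \<Rightarrow> nat set" where
  "allvars (GEq s t) = tvars s \<union> tvars t"
| "allvars (GNot f) = allvars f"
| "allvars (GAnd f g) = allvars f \<union> allvars g"
| "allvars (GEx v f) = insert v (allvars f)"

lemma finite_allvars: "finite (allvars f)"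
proof -
  have "finite (tvars t)" for t by (induction t) auto
  then show ?thesis by (induction f) auto
qed

text \<open>The size of the relations that a position must preserve. An equation
  \<open>s = t\<close> is tested on the word \<open>s t^-1\<close>, with exponents up to
  \<open>tweight s + tweight t\<close>; the \<open>1\<close> keeps the bound positive. A quantifier
  costs the elimination of one vector.\<close>

fun coef_bound :: "gform \<Rightarrow> int" where
  "coef_bound (GEq s t) = 1 + tweight s + tweight t"
| "coef_bound (GNot f) = coef_bound f"
| "coef_bound (GAnd f g) = max (coef_bound f) (coef_bound g)"
| "coef_bound (GEx v f) = 2 * (coef_bound f)\<^sup>2"

text \<open>The factorial is divisible by every coefficient \<open>l\<close> that an answer may have
  to divide by; the product for a conjunction serves as a common multiple.\<close>

fun modulus :: "gform \<Rightarrow> int" where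
  "modulus (GEq s t) = 1"
| "modulus (GNot f) = modulus f"
| "modulus (GAnd f g) = modulus f * modulus g"
| "modulus (GEx v f) = fact (nat (coef_bound f)) * modulus f"

lemma coef_bound_ge_1: "coef_bound f \<ge> 1"
proof (induction f)
  case (GEq s t)
  have "tweight t \<ge> 0" for t by (induction t) auto
  then show ?case by (simp add: add_nonneg_nonneg)
next
  case (GEx v f)
  then have "1 * 1 \<le> coef_bound f * coef_bound f" by (intro mult_mono) auto
  then show ?case by (simp add: power2_eq_square)
qed auto

lemma modulus_pos: "modulus f > 0"
  by (induction f) auto

lemma sat_cong:
  "(\<And>v. v \<in> fvars f \<Longrightarrow> env v = env' v) \<Longrightarrow> sat G env f \<longleftrightarrow> sat G env' f"
proof (induction f arbitrary: env env')
  case (GEq s t)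
  have "teval G env r = teval G env' r" if "tvars r \<subseteq> tvars s \<union> tvars t" for r
    using that GEq by (induction r) auto
  then show ?case by auto
next
  case (GAnd f g)
  then show ?case by (metis UnCI fvars.simps(3) sat.simps(3))
next
  case (GNot f)
  then show ?case by (metis fvars.simps(2) sat.simps(2))
next
  case (GEx v f)
  have "sat G (env(v := a)) f \<longleftrightarrow> sat G (env'(v := a)) f" for a
    using GEx.prems by (intro GEx.IH) auto
  then show ?case by simp
qed

lemma (in group) models_closed_iff:
  assumes "fvars f = {}"
  shows "models G f \<longleftrightarrow> sat G (\<lambda>_. \<one>) f"
proof -
  have "sat G env f \<longleftrightarrow> sat G (\<lambda>_. \<one>) f" for env
    using assms by (intro sat_cong) auto
  moreover have "range (\<lambda>_. \<one>) \<subseteq> carrier G" by auto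
  ultimately show ?thesis unfolding models_def by blast
qed

text \<open>\<open>G\<close> and \<open>H\<close> are fibre products of a common quotient, recorded by the
  correspondence \<open>S\<close>, with lattices in \<open>\<int>\<^sup>p\<close>, recorded by \<open>L\<close> and \<open>L'\<close>. The maps \<open>B\<close> and \<open>B'\<close>
  are inverse to each other only modulo \<open>N0\<close>.\<close>

locale approx_lattices = G: group G + H: group H
  for G :: "('a, 'b) monoid_scheme" and H :: "('c, 'd) monoid_scheme" +
  fixes S :: "'a \<Rightarrow> 'c \<Rightarrow> bool"
    and L :: "'a \<Rightarrow> nat \<Rightarrow> int" and L' :: "'c \<Rightarrow> nat \<Rightarrow> int"
    and p :: nat and E N0 :: int
    and B B' :: "(nat \<Rightarrow> int) \<Rightarrow> nat \<Rightarrow> int"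
  assumes L_mult: "\<And>x y k. x \<in> carrier G \<Longrightarrow> y \<in> carrier G \<Longrightarrow> L (x \<otimes>\<^bsub>G\<^esub> y) k = L x k + L y k"
    and L'_mult: "\<And>x y k. x \<in> carrier H \<Longrightarrow> y \<in> carrier H \<Longrightarrow> L' (x \<otimes>\<^bsub>H\<^esub> y) k = L' x k + L' y k"
    and L_supp: "\<And>x k. x \<in> carrier G \<Longrightarrow> k \<ge> p \<Longrightarrow> L x k = 0"
    and L'_supp: "\<And>x k. x \<in> carrier H \<Longrightarrow> k \<ge> p \<Longrightarrow> L' x k = 0"
    and S_one: "S \<one>\<^bsub>G\<^esub> \<one>\<^bsub>H\<^esub>"
    and S_mult: "\<And>x x' y y'. \<lbrakk>x \<in> carrier G; x' \<in> carrier G; y \<in> carrier H; y' \<in> carrier H; S x y; S x' y'\<rbrakk>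
                   \<Longrightarrow> S (x \<otimes>\<^bsub>G\<^esub> x') (y \<otimes>\<^bsub>H\<^esub> y')"
    and S_inv: "\<And>x y. x \<in> carrier G \<Longrightarrow> y \<in> carrier H \<Longrightarrow> S x y \<Longrightarrow> S (inv\<^bsub>G\<^esub> x) (inv\<^bsub>H\<^esub> y)"
    and S_inj: "\<And>x y. \<lbrakk>x \<in> carrier G; y \<in> carrier H; S x y; \<And>k. L x k = 0; \<And>k. L' y k = 0\<rbrakk>
                   \<Longrightarrow> x = \<one>\<^bsub>G\<^esub> \<longleftrightarrow> y = \<one>\<^bsub>H\<^esub>"
    and B_lin: "\<And>h x. \<And>J::nat set. B (\<lambda>k. \<Sum>v\<in>J. h v * x v k) = (\<lambda>k. \<Sum>v\<in>J. h v * B (x v) k)"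
    and B'_lin: "\<And>h x. \<And>J::nat set. B' (\<lambda>k. \<Sum>v\<in>J. h v * x v k) = (\<lambda>k. \<Sum>v\<in>J. h v * B' (x v) k)"
    and B_supp: "\<And>x k. (\<And>j. j \<ge> p \<Longrightarrow> x j = 0) \<Longrightarrow> k \<ge> p \<Longrightarrow> B x k = 0"
    and B'_supp: "\<And>x k. (\<And>j. j \<ge> p \<Longrightarrow> x j = 0) \<Longrightarrow> k \<ge> p \<Longrightarrow> B' x k = 0"
    and B'_B: "\<And>x k. N0 dvd B' (B x) k - x k"
    and B_B': "\<And>x k. N0 dvd B (B' x) k - x k"
    and forth_ex: "\<And>x a. \<lbrakk>x \<in> carrier G; \<And>k. k \<ge> p \<Longrightarrow> a k = 0; \<And>k. E dvd a k - B (L x) k\<rbrakk>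
                  \<Longrightarrow> \<exists>y\<in>carrier H. S x y \<and> L' y = a"
    and back_ex: "\<And>y a. \<lbrakk>y \<in> carrier H; \<And>k. k \<ge> p \<Longrightarrow> a k = 0; \<And>k. E dvd a k - B' (L' y) k\<rbrakk>
                  \<Longrightarrow> \<exists>x\<in>carrier G. S x y \<and> L x = a"
    and E_pos: "E > 0"
begin

lemma L_one: "L \<one>\<^bsub>G\<^esub> k = 0" and L'_one: "L' \<one>\<^bsub>H\<^esub> k = 0"
  using L_mult[of "\<one>\<^bsub>G\<^esub>" "\<one>\<^bsub>G\<^esub>" k] L'_mult[of "\<one>\<^bsub>H\<^esub>" "\<one>\<^bsub>H\<^esub>" k] by auto

lemma L_inv: "x \<in> carrier G \<Longrightarrow> L (inv\<^bsub>G\<^esub> x) k = - L x k"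
  and L'_inv: "y \<in> carrier H \<Longrightarrow> L' (inv\<^bsub>H\<^esub> y) k = - L' y k"
  using L_mult[of "inv\<^bsub>G\<^esub> x" x k] L'_mult[of "inv\<^bsub>H\<^esub> y" y k] L_one[of k] L'_one[of k] by auto

text \<open>A game position. Relations of size \<open>K\<close> decide the atoms, together with
  \<open>S\<close>; the congruence modulo \<open>N\<close> is the reserve from which later divisions
  are paid.\<close>

definition matched :: "nat \<Rightarrow> int \<Rightarrow> int \<Rightarrow> (nat \<Rightarrow> 'a) \<Rightarrow> (nat \<Rightarrow> 'c) \<Rightarrow> bool" where
  "matched m K N env env' \<longleftrightarrow>
     (\<forall>v<m. env v \<in> carrier G \<and> env' v \<in> carrier H \<and> S (env v) (env' v) \<and>
            (\<forall>k. N dvd L' (env' v) k - B (L (env v)) k)) \<and>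
     (\<forall>h. (\<forall>v. \<bar>h v\<bar> \<le> K) \<longrightarrow>
        (\<forall>k. (\<Sum>v<m. h v * L (env v) k) = 0) \<longleftrightarrow> (\<forall>k. (\<Sum>v<m. h v * L' (env' v) k) = 0))"

lemma matched_mono:
  assumes "matched m K N env env'" "K1 \<le> K" "N1 dvd N"
  shows "matched m K1 N1 env env'"
proof -
  have "\<forall>v. \<bar>h v\<bar> \<le> K" if "\<forall>v. \<bar>h v\<bar> \<le> K1" for h :: "nat \<Rightarrow> int"
    using that assms(2) by (meson order_trans)
  then show ?thesis using assms(1) dvd_trans[OF assms(3)] unfolding matched_def by blast
qed

lemma teval_closed:
  assumes "matched m K N env env'" "tvars t \<subseteq> {..<m}"
  shows "teval G env t \<in> carrier G \<and> teval H env' t \<in> carrier H \<and> S (teval G env t) (teval H env' t)"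
  using assms(2)
proof (induction t)
  case (GVar v)
  then show ?case using assms(1) by (auto simp: matched_def)
qed (auto simp: S_one S_mult S_inv)

lemma L_teval:
  assumes "matched m K N env env'" "tvars t \<subseteq> {..<m}"
  shows "L (teval G env t) k = (\<Sum>v<m. tcoef t v * L (env v) k) \<and>
         L' (teval H env' t) k = (\<Sum>v<m. tcoef t v * L' (env' v) k)"
  using assms(2)
proof (induction t)
  case (GVar v)
  have "(\<Sum>w<m. tcoef (GVar v) w * f w) = f v" for f :: "nat \<Rightarrow> int"
    using GVar by (subst sum.remove[of _ v]) (auto intro!: sum.neutral)
  then show ?case by simp
next
  case (GMul s t)
  then have "tvars s \<subseteq> {..<m}" "tvars t \<subseteq> {..<m}" by auto
  with GMul show ?case using teval_closed[OF assms(1)]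
    by (simp add: L_mult L'_mult distrib_right sum.distrib)
next
  case (GInv t)
  then have "tvars t \<subseteq> {..<m}" by auto
  with GInv show ?case using teval_closed[OF assms(1)]
    by (simp add: L_inv L'_inv sum_negf)
qed (auto simp: L_one L'_one)

text \<open>With \<open>w = s t^-1\<close>, the question is whether \<open>w\<close> is the
  identity. Its lattice coordinates vanish on both sides or on neither, by the bounded relations. If
  they do not vanish, neither value is the identity; if they do, \<open>S_inj\<close> compares the
  two values.\<close>

lemma sat_GEq_iff:
  assumes R: "matched m K N env env'" and K: "K \<ge> coef_bound (GEq s t)"
    and vars: "tvars s \<subseteq> {..<m}" "tvars t \<subseteq> {..<m}"
  shows "sat G env (GEq s t) \<longleftrightarrow> sat H env' (GEq s t)"
proof -
  let ?w = "GMul s (GInv t)"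
  have w: "tvars ?w \<subseteq> {..<m}" using vars by auto
  note cl = teval_closed[OF R vars(1)] teval_closed[OF R vars(2)] teval_closed[OF R w]
  have "\<bar>tcoef ?w v\<bar> \<le> K" for v using abs_tcoef_le[of ?w v] K by simp
  then have rel: "(\<forall>k. L (teval G env ?w) k = 0) \<longleftrightarrow> (\<forall>k. L' (teval H env' ?w) k = 0)"
    using R conjunct1[OF L_teval[OF R w]] conjunct2[OF L_teval[OF R w]] unfolding matched_def by presburger
  have "teval G env ?w = \<one>\<^bsub>G\<^esub> \<longleftrightarrow> teval H env' ?w = \<one>\<^bsub>H\<^esub>"
  proof (cases "\<forall>k. L (teval G env ?w) k = 0")
    case True
    then show ?thesis using rel S_inj cl by blast
  next
    case False
    then show ?thesis using rel L_one L'_one by metis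
  qed
  moreover have "teval G env ?w = \<one>\<^bsub>G\<^esub> \<longleftrightarrow> teval G env s = teval G env t"
    using cl G.inv_solve_right'[of "\<one>\<^bsub>G\<^esub>" "teval G env s" "teval G env t"] by auto
  moreover have "teval H env' ?w = \<one>\<^bsub>H\<^esub> \<longleftrightarrow> teval H env' s = teval H env' t"
    using cl H.inv_solve_right'[of "\<one>\<^bsub>H\<^esub>" "teval H env' s" "teval H env' t"] by auto
  ultimately show ?thesis by simp
qed

text \<open>Makes positions symmetric, so that both kinds of move rest on
  \<open>extend_approximation\<close>.\<close>

lemma dvd_switch:
  assumes "N dvd N0"
  shows "(\<forall>k. N dvd y k - B x k) \<longleftrightarrow> (\<forall>k. N dvd x k - B' y k)"
proof -
  have 1: "N dvd B' (B x) k - x k" "N dvd B (B' y) k - y k" for k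
    using B'_B B_B' assms dvd_trans by blast+
  have 2: "N dvd x k - B' y k" if "\<forall>k. N dvd y k - B x k" for k
  proof -
    have "N dvd B' y k - B' (B x) k" using that by (intro lin_dvd_diff[OF B'_lin]) auto
    with 1(1)[of k] have "N dvd (B' y k - B' (B x) k) + (B' (B x) k - x k)" by (rule dvd_add[rotated])
    then show ?thesis by (simp add: dvd_diff_commute)
  qed
  have "N dvd y k - B x k" if "\<forall>k. N dvd x k - B' y k" for k
  proof -
    have "N dvd B x k - B (B' y) k" using that by (intro lin_dvd_diff[OF B_lin]) auto
    with 1(2)[of k] have "N dvd (B x k - B (B' y) k) + (B (B' y) k - y k)" by (rule dvd_add[rotated])
    then show ?thesis by (simp add: dvd_diff_commute)
  qed
  with 2 show ?thesis by blast
qed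

lemma fact_dvd_cond:
  assumes "fact (nat K) * N1 dvd (N::int)" "l \<noteq> 0" "\<bar>l\<bar> \<le> K"
  shows "l * N1 dvd N"
proof -
  have "nat \<bar>l\<bar> dvd fact (nat K)" using assms by (intro dvd_fact) auto
  then have "int (nat \<bar>l\<bar>) dvd int (fact (nat K))" by (simp only: int_dvd_int_iff)
  then have "l dvd fact (nat K)" by simp
  then show ?thesis using assms(1) by (meson dvd_trans mult_dvd_mono dvd_refl)
qed

lemma matched_upd:
  assumes R: "matched m K N env env'" and "v0 < m" and cl: "x \<in> carrier G" "y \<in> carrier H" "S x y"
    and N: "N1 dvd N" "\<And>k. N1 dvd L' y k - B (L x) k"
    and rel: "\<And>h. (\<forall>v. \<bar>h v\<bar> \<le> K1) \<Longrightarrow>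
       (\<forall>k. (\<Sum>v<m. h v * ((\<lambda>v. L (env v))(v0 := L x)) v k) = 0) \<longleftrightarrow>
       (\<forall>k. (\<Sum>v<m. h v * ((\<lambda>v. L' (env' v))(v0 := L' y)) v k) = 0)"
  shows "matched m K1 N1 (env(v0 := x)) (env'(v0 := y))"
proof -
  have "(\<lambda>v. L ((env(v0 := x)) v)) = (\<lambda>v. L (env v))(v0 := L x)"
    "(\<lambda>v. L' ((env'(v0 := y)) v)) = (\<lambda>v. L' (env' v))(v0 := L' y)" by auto
  then have *: "L ((env(v0 := x)) v) = ((\<lambda>v. L (env v))(v0 := L x)) v"
    "L' ((env'(v0 := y)) v) = ((\<lambda>v. L' (env' v))(v0 := L' y)) v" for v by (auto dest: fun_cong)
  show ?thesis
    unfolding matched_def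
  proof (intro conjI allI impI)
    fix h :: "nat \<Rightarrow> int" assume "\<forall>v. \<bar>h v\<bar> \<le> K1"
    from rel[rule_format, of h] this show "(\<forall>k. (\<Sum>v<m. h v * L ((env(v0 := x)) v) k) = 0) \<longleftrightarrow>
       (\<forall>k. (\<Sum>v<m. h v * L' ((env'(v0 := y)) v) k) = 0)" unfolding * by blast
  qed (use R cl N in \<open>auto simp: matched_def intro: dvd_trans\<close>)
qed

text \<open>The vector from \<open>extend_approximation\<close> is congruent to
  \<open>B (L x)\<close> modulo \<open>N1\<close>, hence modulo \<open>E\<close>, and
  \<open>forth_ex\<close> realises it by an element that corresponds to \<open>x\<close> under
  \<open>S\<close>.\<close>

lemma matched_forth:
  assumes R: "matched m (2 * K\<^sup>2) N env env'" and N: "fact (nat K) * N1 dvd N" "E dvd N1" "N1 > 0"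
    and K: "K \<ge> 1" and v0: "v0 < m" and x: "x \<in> carrier G"
  shows "\<exists>y\<in>carrier H. matched m K N1 (env(v0 := x)) (env'(v0 := y))"
proof -
  have "\<exists>b'. (\<forall>k\<ge>p. b' k = 0) \<and> (\<forall>k. N1 dvd b' k - B (L x) k) \<and>
     (\<forall>h. (\<forall>v. \<bar>h v\<bar> \<le> K) \<longrightarrow>
       (\<forall>k. (\<Sum>v<m. h v * ((\<lambda>v. L (env v))(v0 := L x)) v k) = 0) \<longleftrightarrow>
       (\<forall>k. (\<Sum>v<m. h v * ((\<lambda>v. L' (env' v))(v0 := b')) v k) = 0))"
    by (rule extend_approximation[where N = N])
       (use R N K v0 x in \<open>auto simp: matched_def L'_supp L_supp B_supp B_lin intro: fact_dvd_cond\<close>)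
  then obtain b' where b': "\<And>k. k \<ge> p \<Longrightarrow> b' k = 0" "\<And>k. N1 dvd b' k - B (L x) k"
    and rel: "\<And>h. (\<forall>v. \<bar>h v\<bar> \<le> K) \<Longrightarrow>
       (\<forall>k. (\<Sum>v<m. h v * ((\<lambda>v. L (env v))(v0 := L x)) v k) = 0) \<longleftrightarrow>
       (\<forall>k. (\<Sum>v<m. h v * ((\<lambda>v. L' (env' v))(v0 := b')) v k) = 0)"
    by blast
  obtain y where y: "y \<in> carrier H" "S x y" "L' y = b'"
    using forth_ex[OF x b'(1) dvd_trans[OF N(2) b'(2)]] by blast
  have "N1 dvd N" using N(1) dvd_mult_right by blast
  then have "matched m K N1 (env(v0 := x)) (env'(v0 := y))"
    using R v0 x y b' rel by (intro matched_upd[OF R]) auto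
  then show ?thesis using y by blast
qed

text \<open>The mirror image with \<open>B'\<close>. Here \<open>N dvd N0\<close> is what turns the
  congruences for \<open>B\<close> into congruences for \<open>B'\<close> and back.\<close>

lemma matched_back:
  assumes R: "matched m (2 * K\<^sup>2) N env env'" and N: "fact (nat K) * N1 dvd N" "E dvd N1" "N1 > 0" "N dvd N0"
    and K: "K \<ge> 1" and v0: "v0 < m" and y: "y \<in> carrier H"
  shows "\<exists>x\<in>carrier G. matched m K N1 (env(v0 := x)) (env'(v0 := y))"
proof -
  have N1: "N1 dvd N" "N1 dvd N0" using N dvd_mult_right dvd_trans by blast+
  have sw: "N dvd L (env v) k - B' (L' (env' v)) k" if "v < m" for v k
    using R that dvd_switch[OF N(4)] unfolding matched_def by blast
  have "\<exists>b'. (\<forall>k\<ge>p. b' k = 0) \<and> (\<forall>k. N1 dvd b' k - B' (L' y) k) \<and>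
     (\<forall>h. (\<forall>v. \<bar>h v\<bar> \<le> K) \<longrightarrow>
       (\<forall>k. (\<Sum>v<m. h v * ((\<lambda>v. L' (env' v))(v0 := L' y)) v k) = 0) \<longleftrightarrow>
       (\<forall>k. (\<Sum>v<m. h v * ((\<lambda>v. L (env v))(v0 := b')) v k) = 0))"
    by (rule extend_approximation[where N = N])
       (use R N K v0 y sw in \<open>auto simp: matched_def L'_supp L_supp B'_supp B'_lin intro: fact_dvd_cond\<close>)
  then obtain b' where b': "\<And>k. k \<ge> p \<Longrightarrow> b' k = 0" "\<And>k. N1 dvd b' k - B' (L' y) k"
    and rel: "\<And>h. (\<forall>v. \<bar>h v\<bar> \<le> K) \<Longrightarrow>
       (\<forall>k. (\<Sum>v<m. h v * ((\<lambda>v. L' (env' v))(v0 := L' y)) v k) = 0) \<longleftrightarrow>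
       (\<forall>k. (\<Sum>v<m. h v * ((\<lambda>v. L (env v))(v0 := b')) v k) = 0)"
    by blast
  obtain x where x: "x \<in> carrier G" "S x y" "L x = b'"
    using back_ex[OF y b'(1) dvd_trans[OF N(2) b'(2)]] by blast
  have "N1 dvd L' y k - B (L x) k" for k
    using b'(2) x(3) dvd_switch[OF N1(2)] by blast
  then have "matched m K N1 (env(v0 := x)) (env'(v0 := y))"
    using R v0 x y N1 rel by (intro matched_upd[OF R]) auto
  then show ?thesis using x by blast
qed

lemma sat_iff_sat:
  assumes "matched m K N env env'" "coef_bound f \<le> K" "E * modulus f dvd N" "N dvd N0" "N > 0"
    and "allvars f \<subseteq> {..<m}"
  shows "sat G env f \<longleftrightarrow> sat H env' f"
  using assms
proof (induction f arbitrary: K N env env')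
  case (GEq s t)
  then show ?case by (intro sat_GEq_iff[of m K N]) auto
next
  case (GNot f)
  then show ?case by simp
next
  case (GAnd f g)
  have "E * modulus f dvd N" "E * modulus g dvd N"
    using GAnd.prems(3) by (auto elim!: dvd_trans[rotated])
  with GAnd show ?case by simp
next
  case (GEx v f)
  \<comment> \<open>The modulus left after this move; the factor \<open>E\<close> guarantees that
    the vectors found can be realised by group elements.\<close>
  define N1 where "N1 = E * modulus f"
  have N1: "fact (nat (coef_bound f)) * N1 dvd N" "E dvd N1" "N1 > 0" "E * modulus f dvd N1"
    using GEx.prems(3) E_pos modulus_pos[of f] by (auto simp: N1_def mult_ac)
  have N1': "N1 dvd N0" using N1(1) GEx.prems(4) dvd_mult_right dvd_trans by blast
  have R: "matched m (2 * (coef_bound f)\<^sup>2) N env env'"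
    using matched_mono[OF GEx.prems(1)] GEx.prems(2) by simp
  have v: "v < m" "allvars f \<subseteq> {..<m}" using GEx.prems(6) by auto
  have IH: "sat G (env(v := x)) f \<longleftrightarrow> sat H (env'(v := y)) f"
    if "matched m (coef_bound f) N1 (env(v := x)) (env'(v := y))" for x y
    using GEx.IH[OF that _ N1(4) N1' N1(3) v(2)] by blast
  show ?case
  proof
    assume "sat G env (GEx v f)"
    then obtain x where x: "x \<in> carrier G" "sat G (env(v := x)) f" by auto
    with matched_forth[OF R N1(1-3) coef_bound_ge_1 v(1) x(1)] IH
    show "sat H env' (GEx v f)" by auto
  next
    assume "sat H env' (GEx v f)"
    then obtain y where y: "y \<in> carrier H" "sat H (env'(v := y)) f" by auto
    with matched_back[OF R N1(1-3) GEx.prems(4) coef_bound_ge_1 v(1) y(1)] IH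
    show "sat G env (GEx v f)" by auto
  qed
qed

text \<open>The modulus \<open>N0\<close>, and with it the pair \<open>B\<close>, \<open>B'\<close>,
  is tied to the sentence. The game starts with every variable at the identity, where all
  coordinates vanish.\<close>

lemma models_iff_models:
  assumes "fvars f = {}" "N0 = E * modulus f"
  shows "models G f \<longleftrightarrow> models H f"
proof -
  obtain m where m: "allvars f \<subseteq> {..<m}"
    using finite_allvars finite_nat_iff_bounded by blast
  have B0: "B (\<lambda>k. 0) k = 0" for k
    using B_lin[of "\<lambda>_. 0" "\<lambda>_ _. 0" "{}"] by (simp add: fun_eq_iff)
  have "L \<one>\<^bsub>G\<^esub> = (\<lambda>k. 0)" using L_one by auto
  then have "matched m (coef_bound f) N0 (\<lambda>_. \<one>\<^bsub>G\<^esub>) (\<lambda>_. \<one>\<^bsub>H\<^esub>)"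
    by (simp add: matched_def S_one L'_one B0)
  then have "sat G (\<lambda>_. \<one>\<^bsub>G\<^esub>) f \<longleftrightarrow> sat H (\<lambda>_. \<one>\<^bsub>H\<^esub>) f"
    using assms m E_pos modulus_pos[of f] by (intro sat_iff_sat[of m "coef_bound f" N0]) auto
  then show ?thesis using G.models_closed_iff H.models_closed_iff assms by blast
qed

end

section \<open>Complements of pure subgroups\<close>

context comm_group
begin

lemma finprod_int_pow_add:
  fixes k h :: "nat \<Rightarrow> int"
  assumes "b \<in> I \<rightarrow> carrier G"
  shows "(\<Otimes>i\<in>I. b i [^] (k i + h i)) = (\<Otimes>i\<in>I. b i [^] k i) \<otimes> (\<Otimes>i\<in>I. b i [^] h i)"
proof -
  have "(\<Otimes>i\<in>I. b i [^] (k i + h i)) = (\<Otimes>i\<in>I. b i [^] k i \<otimes> b i [^] h i)"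
    using assms by (intro finprod_cong) (auto simp: int_pow_mult Pi_iff)
  also have "\<dots> = (\<Otimes>i\<in>I. b i [^] k i) \<otimes> (\<Otimes>i\<in>I. b i [^] h i)"
    using assms by (intro finprod_multf) (auto simp: Pi_iff)
  finally show ?thesis .
qed

lemma finprod_int_pow_minus:
  fixes k :: "nat \<Rightarrow> int"
  assumes "b \<in> I \<rightarrow> carrier G"
  shows "(\<Otimes>i\<in>I. b i [^] (- k i)) = inv (\<Otimes>i\<in>I. b i [^] k i)"
proof -
  have "(\<Otimes>i\<in>I. b i [^] (- k i)) \<otimes> (\<Otimes>i\<in>I. b i [^] k i) = \<one>"
    using finprod_int_pow_add[OF assms, of "\<lambda>i. - k i" k] by simp
  moreover have "(\<Otimes>i\<in>I. b i [^] h i) \<in> carrier G" for h :: "nat \<Rightarrow> int"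
    using assms by (intro finprod_closed) (auto simp: Pi_iff)
  ultimately show ?thesis by (metis inv_equality)
qed

text \<open>A step of Euclid's algorithm: a column operation on the family \<open>b\<close> is
  compensated by the inverse row operation on the exponents.\<close>

lemma finprod_transvection:
  fixes h :: "nat \<Rightarrow> int" and \<sigma> :: int
  assumes I: "finite I" "i \<in> I" "j \<in> I" "i \<noteq> j" and b: "b \<in> I \<rightarrow> carrier G"
  shows "(\<Otimes>v\<in>I. b v [^] h v) =
    (\<Otimes>v\<in>I. (b(j := b j \<otimes> b i [^] \<sigma>)) v [^] (h(i := h i - \<sigma> * h j)) v)"
proof -
  let ?b = "b(j := b j \<otimes> b i [^] \<sigma>)" and ?h = "h(i := h i - \<sigma> * h j)"
  define J where "J = I - {i, j}"
  have J: "I = insert i (insert j J)" "finite J" "i \<notin> insert j J" "j \<notin> J" using I by (auto simp: J_def)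
  have c: "b i \<in> carrier G" "b j \<in> carrier G" "\<And>v. v \<in> J \<Longrightarrow> b v \<in> carrier G"
    using b I by (auto simp: J_def Pi_iff)
  let ?R = "\<Otimes>v\<in>J. b v [^] h v"
  have R: "?R \<in> carrier G" using c by (intro finprod_closed) auto
  have R': "(\<Otimes>v\<in>J. ?b v [^] ?h v) = ?R" using c J by (intro finprod_cong') auto
  have "(\<Otimes>v\<in>I. b v [^] h v) = b i [^] h i \<otimes> (b j [^] h j \<otimes> ?R)"
    using J c by (simp add: Pi_iff)
  moreover have "(\<Otimes>v\<in>I. ?b v [^] ?h v) = b i [^] (h i - \<sigma> * h j) \<otimes> ((b j \<otimes> b i [^] \<sigma>) [^] h j \<otimes> ?R)"
    using J c R' by (simp add: Pi_iff)
  moreover have "(b j \<otimes> b i [^] \<sigma>) [^] h j = b j [^] h j \<otimes> b i [^] (\<sigma> * h j)"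
    using c by (simp add: int_pow_distrib int_pow_pow)
  moreover have "b i [^] h i = b i [^] (h i - \<sigma> * h j) \<otimes> b i [^] (\<sigma> * h j)"
    using c by (simp add: int_pow_mult[symmetric])
  ultimately show ?thesis using c R by (simp add: m_ac)
qed

definition spans_mod :: "'a set \<Rightarrow> 'a set \<Rightarrow> nat set \<Rightarrow> (nat \<Rightarrow> 'a) \<Rightarrow> bool" where
  "spans_mod F M I b \<longleftrightarrow> finite I \<and> b \<in> I \<rightarrow> F \<and>
     (\<forall>x\<in>carrier G. \<exists>k :: nat \<Rightarrow> int. \<exists>m\<in>M. x = (\<Otimes>i\<in>I. b i [^] k i) \<otimes> m)"

lemma ex_spans_mod:
  assumes M: "subgroup M G" and F: "subgroup F G" and FM: "F <#> M = carrier G"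
    and S: "finite S" "S \<subseteq> carrier G" "generate G S = carrier G"
  shows "\<exists>I b. spans_mod F M I b"
proof -
  interpret M: subgroup M G by (fact M)
  interpret F: subgroup F G by (fact F)
  obtain g :: "nat \<Rightarrow> 'a" and N where g: "S = g ` {..<N}"
    using S(1) finite_imp_nat_seg_image_inj_on[of S] by (metis lessThan_def)
  have "\<exists>f m. f \<in> F \<and> m \<in> M \<and> g i = f \<otimes> m" if "i < N" for i
  proof -
    have "g i \<in> F <#> M" using that g S(2) FM by auto
    then show ?thesis unfolding set_mult_def by auto
  qed
  then obtain b m where bm: "\<And>i. i < N \<Longrightarrow> b i \<in> F \<and> m i \<in> M \<and> g i = b i \<otimes> m i" by metis
  let ?I = "{..<N}"
  have bc: "b \<in> ?I \<rightarrow> carrier G" using bm F.subset by auto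
  have c: "(\<Otimes>i\<in>?I. b i [^] k i) \<in> carrier G" for k :: "nat \<Rightarrow> int"
    using bc by (intro finprod_closed) (auto simp: Pi_iff)
  have gen: "\<exists>k :: nat \<Rightarrow> int. \<exists>m\<in>M. g i = (\<Otimes>i\<in>?I. b i [^] k i) \<otimes> m" if i: "i < N" for i
  proof -
    have "(\<Otimes>v\<in>?I. b v [^] (if v = i then 1 else 0 :: int)) = (\<Otimes>v\<in>?I. if i = v then b v else \<one>)"
      using bc by (intro finprod_cong') (auto simp: Pi_iff)
    also have "\<dots> = b i" using i bc by (intro finprod_singleton) auto
    finally have "g i = (\<Otimes>v\<in>?I. b v [^] (if v = i then 1 else 0 :: int)) \<otimes> m i" using bm[OF i] by simp
    then show ?thesis using bm[OF i] by (intro exI[of _ "\<lambda>v. if v = i then 1 else 0"]) blast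
  qed
  have "\<exists>k :: nat \<Rightarrow> int. \<exists>m\<in>M. x = (\<Otimes>i\<in>?I. b i [^] k i) \<otimes> m" if "x \<in> generate G S" for x
    using that
  proof (induction x rule: generate.induct)
    case one
    have "\<one> = (\<Otimes>i\<in>?I. b i [^] (0::int)) \<otimes> \<one>" by simp
    then show ?case using M.one_closed by (intro exI[of _ "\<lambda>_. 0"]) blast
  next
    case (incl x)
    then show ?case using gen g by auto
  next
    case (inv x)
    then obtain i where "i < N" "x = g i" using g by auto
    with gen obtain k :: "nat \<Rightarrow> int" and m where "m \<in> M" "x = (\<Otimes>i\<in>?I. b i [^] k i) \<otimes> m" by blast
    then have "inv x = (\<Otimes>i\<in>?I. b i [^] (- k i)) \<otimes> inv m" "inv m \<in> M"
      using c M.mem_carrier finprod_int_pow_minus[OF bc, of k] by (auto simp: inv_mult)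
    then show ?case by (intro exI[of _ "\<lambda>i. - k i"]) blast
  next
    case (eng x y)
    then obtain k h :: "nat \<Rightarrow> int" and m m' where m: "m \<in> M" "m' \<in> M"
      and "x = (\<Otimes>i\<in>?I. b i [^] k i) \<otimes> m" "y = (\<Otimes>i\<in>?I. b i [^] h i) \<otimes> m'" by auto
    then have "x \<otimes> y = (\<Otimes>i\<in>?I. b i [^] (k i + h i)) \<otimes> (m \<otimes> m')"
      using c M.mem_carrier finprod_int_pow_add[OF bc, of k h] by (simp add: m_ac)
    then show ?case using m M.m_closed by (intro exI[of _ "\<lambda>i. k i + h i"]) blast
  qed
  then have "spans_mod F M ?I b"
    unfolding spans_mod_def using bm S(3) by auto
  then show ?thesis by blast
qed

lemma spans_mod_transvection:
  fixes \<sigma> :: int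
  assumes "spans_mod F M I b" and F: "subgroup F G" and I: "i \<in> I" "j \<in> I" "i \<noteq> j"
  shows "spans_mod F M I (b(j := b j \<otimes> b i [^] \<sigma>))"
proof -
  interpret F: subgroup F G by (fact F)
  have b: "finite I" "b \<in> I \<rightarrow> F" "b \<in> I \<rightarrow> carrier G"
    and sp: "\<forall>x\<in>carrier G. \<exists>k :: nat \<Rightarrow> int. \<exists>m\<in>M. x = (\<Otimes>i\<in>I. b i [^] k i) \<otimes> m"
    using assms(1) F.subset by (auto simp: spans_mod_def)
  have "b i [^] \<sigma> \<in> F" using b I by (intro subgroup_int_pow_closed[OF F]) auto
  then have "b(j := b j \<otimes> b i [^] \<sigma>) \<in> I \<rightarrow> F"
    using b(2) I by (auto simp: Pi_iff)
  moreover have "\<exists>k :: nat \<Rightarrow> int. \<exists>m\<in>M. x = (\<Otimes>v\<in>I. (b(j := b j \<otimes> b i [^] \<sigma>)) v [^] k v) \<otimes> m"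
    if "x \<in> carrier G" for x
    using sp[rule_format, OF that] finprod_transvection[OF b(1) I b(3)] by metis
  ultimately show ?thesis using b by (auto simp: spans_mod_def)
qed

text \<open>Euclid's algorithm on the exponents of a relation, applied to a spanning family of minimal size.\<close>

lemma spans_mod_minimal_independent:
  fixes k :: "nat \<Rightarrow> int"
  assumes M: "subgroup M G" and F: "subgroup F G"
    and pure: "\<And>x k. x \<in> carrier G \<Longrightarrow> k \<noteq> (0::int) \<Longrightarrow> x [^] k \<in> M \<Longrightarrow> x \<in> M"
    and min: "\<And>I' b'. spans_mod F M I' b' \<Longrightarrow> card I \<le> card I'"
    and "spans_mod F M I b" "(\<Otimes>i\<in>I. b i [^] k i) \<in> M" "i \<in> I"
  shows "k i = 0"
  using assms(5-7)
proof (induction "nat (\<Sum>i\<in>I. \<bar>k i\<bar>)" arbitrary: b k i rule: less_induct)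
  case less
  interpret M: subgroup M G by (fact M)
  interpret F: subgroup F G by (fact F)
  have b: "finite I" "b \<in> I \<rightarrow> F" "b \<in> I \<rightarrow> carrier G"
    and sp: "\<forall>x\<in>carrier G. \<exists>k :: nat \<Rightarrow> int. \<exists>m\<in>M. x = (\<Otimes>i\<in>I. b i [^] k i) \<otimes> m"
    using less.prems(1) F.subset by (auto simp: spans_mod_def)
  \<comment> \<open>The transvection changes only the exponent at \<open>i'\<close>, so the
    induction hypothesis for the smaller exponents already speaks about \<open>k j'\<close>.\<close>
  have step: "k j' = 0" if ij: "i' \<in> I" "j' \<in> I" "i' \<noteq> j'" "\<bar>k j'\<bar> \<le> \<bar>k i'\<bar>" for i' j'
  proof (rule ccontr)
    assume nz: "k j' \<noteq> 0"
    \<comment> \<open>With this sign the new exponent has absolute value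
      \<open>\<bar>k i'\<bar> - \<bar>k j'\<bar>\<close>.\<close>
    define \<sigma> where "\<sigma> = sgn (k i') * sgn (k j')"
    let ?h = "k(i' := k i' - \<sigma> * k j')"
    have "\<bar>k i' - \<sigma> * k j'\<bar> < \<bar>k i'\<bar>" using nz ij(4) by (auto simp: \<sigma>_def sgn_if)
    then have "(\<Sum>v\<in>I. \<bar>?h v\<bar>) < (\<Sum>v\<in>I. \<bar>k v\<bar>)"
      using ij b by (intro sum_strict_mono_ex1) auto
    moreover have "0 \<le> (\<Sum>v\<in>I. \<bar>?h v\<bar>)" by (intro sum_nonneg) auto
    ultimately have lt: "nat (\<Sum>v\<in>I. \<bar>?h v\<bar>) < nat (\<Sum>v\<in>I. \<bar>k v\<bar>)" by linarith
    have "?h j' = 0"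
    proof (rule less.hyps[OF lt _ _ ij(2)])
      show "spans_mod F M I (b(j' := b j' \<otimes> b i' [^] \<sigma>))"
        by (rule spans_mod_transvection[OF less.prems(1) F ij(1-3)])
      show "(\<Otimes>v\<in>I. (b(j' := b j' \<otimes> b i' [^] \<sigma>)) v [^] ?h v) \<in> M"
        using less.prems(2) finprod_transvection[OF b(1) ij(1-3) b(3)] by simp
    qed
    then show False using nz ij by simp
  qed
  show ?case
  proof (rule ccontr)
    assume nz: "k i \<noteq> 0"
    have z: "k j = 0" if "j \<in> I" "j \<noteq> i" for j
      using step[of i j] step[of j i] that less.prems(3) nz by linarith
    let ?I = "I - {i}"
    have ins: "(\<Otimes>v\<in>I. b v [^] h v) = b i [^] h i \<otimes> (\<Otimes>v\<in>?I. b v [^] h v)" for h :: "nat \<Rightarrow> int"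
      using b less.prems(3) finprod_insert[of ?I i "\<lambda>v. b v [^] h v"] by (auto simp: insert_absorb Pi_iff)
    have bi: "b i \<in> carrier G" using b less.prems(3) by auto
    have "(\<Otimes>v\<in>?I. b v [^] k v) = \<one>" using z by (intro finprod_one_eqI) auto
    \<comment> \<open>Only the exponent at \<open>i\<close> survives. Purity puts \<open>b i\<close>
      itself into \<open>M\<close>, so the family spans without it, against minimality.\<close>
    then have "b i [^] k i \<in> M" using less.prems(2) ins[of k] bi by simp
    then have bM: "b i \<in> M" using pure[OF bi nz] by simp
    have "\<exists>h :: nat \<Rightarrow> int. \<exists>m\<in>M. x = (\<Otimes>i\<in>?I. b i [^] h i) \<otimes> m" if x: "x \<in> carrier G" for x
    proof -
      obtain h :: "nat \<Rightarrow> int" and m where m: "m \<in> M" "x = (\<Otimes>i\<in>I. b i [^] h i) \<otimes> m"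
        using sp x by blast
      have "(\<Otimes>v\<in>?I. b v [^] h v) \<in> carrier G" using b by (intro finprod_closed) (auto simp: Pi_iff)
      then have "x = (\<Otimes>i\<in>?I. b i [^] h i) \<otimes> (b i [^] h i \<otimes> m)"
        using m bi M.mem_carrier by (simp add: ins m_ac)
      moreover have "b i [^] h i \<otimes> m \<in> M" using m bM subgroup_int_pow_closed[OF M] by auto
      ultimately show ?thesis by blast
    qed
    then have "spans_mod F M ?I b" using b by (auto simp: spans_mod_def)
    from min[OF this] show False using card_Diff1_less[OF b(1) less.prems(3)] by simp
  qed
qed

text \<open>The quotient by \<open>M\<close> is finitely generated and torsion-free, hence free, so
  \<open>M\<close> splits off. A spanning family of minimal size is independent modulo
  \<open>M\<close>; drawing it from \<open>F\<close> keeps the complement inside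
  \<open>F\<close>.\<close>

lemma pure_subgroup_complement:
  assumes M: "subgroup M G" and F: "subgroup F G" and FM: "F <#> M = carrier G"
    and pure: "\<And>x k. x \<in> carrier G \<Longrightarrow> k \<noteq> (0::int) \<Longrightarrow> x [^] k \<in> M \<Longrightarrow> x \<in> M"
    and S: "finite S" "S \<subseteq> carrier G" "generate G S = carrier G"
  shows "\<exists>C. subgroup C G \<and> C \<subseteq> F \<and> C \<inter> M = {\<one>} \<and> C <#> M = carrier G"
proof -
  interpret M: subgroup M G by (fact M)
  interpret F: subgroup F G by (fact F)
  obtain I b where sp: "spans_mod F M I b" and min: "\<And>I' b'. spans_mod F M I' b' \<Longrightarrow> card I \<le> card I'"
  proof -
    define P where "P n \<longleftrightarrow> (\<exists>I b. spans_mod F M I b \<and> card I = n)" for n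
    have "\<exists>n. P n" using ex_spans_mod[OF M F FM S] by (auto simp: P_def)
    then have "P (LEAST n. P n)" "\<And>n. P n \<Longrightarrow> (LEAST n. P n) \<le> n" by (auto intro: LeastI Least_le)
    then show ?thesis using that unfolding P_def by metis
  qed
  have b: "finite I" "b \<in> I \<rightarrow> F" "b \<in> I \<rightarrow> carrier G"
    and sp': "\<forall>x\<in>carrier G. \<exists>k :: nat \<Rightarrow> int. \<exists>m\<in>M. x = (\<Otimes>i\<in>I. b i [^] k i) \<otimes> m"
    using sp F.subset by (auto simp: spans_mod_def)
  define C where "C = range (\<lambda>k :: nat \<Rightarrow> int. \<Otimes>i\<in>I. b i [^] k i)"
  have CF: "(\<Otimes>i\<in>J. b i [^] k i) \<in> F" if "finite J" "J \<subseteq> I" for J and k :: "nat \<Rightarrow> int"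
    using that
  proof (induction J rule: finite_induct)
    case (insert i J)
    then have "b i [^] k i \<in> F" using b by (intro subgroup_int_pow_closed[OF F]) auto
    moreover have "(\<Otimes>i\<in>insert i J. b i [^] k i) = b i [^] k i \<otimes> (\<Otimes>i\<in>J. b i [^] k i)"
      using insert b by (intro finprod_insert) (auto simp: Pi_iff)
    ultimately show ?case using insert by simp
  qed simp
  then have CF: "C \<subseteq> F" using b by (auto simp: C_def)
  have "subgroup C G"
  proof (rule subgroupI)
    show "C \<subseteq> carrier G" "C \<noteq> {}" using CF F.subset by (auto simp: C_def)
  next
    fix x assume "x \<in> C"
    then obtain k :: "nat \<Rightarrow> int" where "x = (\<Otimes>i\<in>I. b i [^] k i)" by (auto simp: C_def)
    then have "inv x = (\<Otimes>i\<in>I. b i [^] (- k i))" using finprod_int_pow_minus[OF b(3), of k] by simp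
    then show "inv x \<in> C" unfolding C_def by (rule range_eqI[of _ _ "\<lambda>i. - k i"])
  next
    fix x y assume "x \<in> C" "y \<in> C"
    then obtain k h :: "nat \<Rightarrow> int" where "x = (\<Otimes>i\<in>I. b i [^] k i)" "y = (\<Otimes>i\<in>I. b i [^] h i)"
      by (auto simp: C_def)
    then have "x \<otimes> y = (\<Otimes>i\<in>I. b i [^] (k i + h i))" using finprod_int_pow_add[OF b(3), of k h] by simp
    then show "x \<otimes> y \<in> C" unfolding C_def by (rule range_eqI[of _ _ "\<lambda>i. k i + h i"])
  qed
  moreover have "C \<inter> M = {\<one>}"
  proof -
    have "x = \<one>" if x: "x \<in> C" "x \<in> M" for x
    proof -
      obtain k :: "nat \<Rightarrow> int" where k: "x = (\<Otimes>i\<in>I. b i [^] k i)" using x by (auto simp: C_def)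
      have "k i = 0" if "i \<in> I" for i
      proof (rule spans_mod_minimal_independent[OF M F _ _ sp _ that])
        show "(\<Otimes>i\<in>I. b i [^] k i) \<in> M" using x(2) k by simp
      qed (fact pure, fact min)
      then show ?thesis unfolding k by (intro finprod_one_eqI) auto
    qed
    moreover have "\<one> \<in> C" using \<open>subgroup C G\<close> by (rule subgroup.one_closed)
    ultimately show ?thesis using M.one_closed by blast
  qed
  moreover have "C <#> M = carrier G"
  proof
    show "C <#> M \<subseteq> carrier G" using CF F.subset M.subset by (auto simp: set_mult_def)
    show "carrier G \<subseteq> C <#> M"
    proof
      fix x assume "x \<in> carrier G"
      then obtain k :: "nat \<Rightarrow> int" and m where "m \<in> M" "x = (\<Otimes>i\<in>I. b i [^] k i) \<otimes> m" using sp' by blast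
      then show "x \<in> C <#> M" by (auto simp: set_mult_def C_def)
    qed
  qed
  ultimately show ?thesis using CF by blast
qed

end

section \<open>Isolators, the centre, and complements in a nonabelian group\<close>

context group
begin

lemma commutator_mem_derived:
  "x \<in> carrier G \<Longrightarrow> y \<in> carrier G \<Longrightarrow> x \<otimes> y \<otimes> inv x \<otimes> inv y \<in> comm_subgroup G"
  unfolding derived_def by (rule generate.incl) blast

lemma normal_of_derived_subset:
  assumes K: "subgroup K G" and D: "comm_subgroup G \<subseteq> K"
  shows "K \<lhd> G"
proof (rule normal_invI[OF K])
  interpret K: subgroup K G by (fact K)
  fix x h assume x: "x \<in> carrier G" and h: "h \<in> K"
  have "x \<otimes> h \<otimes> inv x \<otimes> inv h \<in> K"
    using x K.mem_carrier[OF h] D commutator_mem_derived by blast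
  then have "x \<otimes> h \<otimes> inv x \<otimes> inv h \<otimes> h \<in> K" using h by simp
  then show "x \<otimes> h \<otimes> inv x \<in> K" using x K.mem_carrier[OF h] by (simp add: m_assoc)
qed

lemma rcos_eq_iff:
  assumes "subgroup K G" "x \<in> carrier G" "y \<in> carrier G"
  shows "K #> x = K #> y \<longleftrightarrow> x \<otimes> inv y \<in> K"
proof
  interpret K: subgroup K G by fact
  assume "K #> x = K #> y"
  then have "x \<in> K #> y" using rcos_self assms by metis
  then obtain h where "h \<in> K" "x = h \<otimes> y" by (auto simp: r_coset_def)
  then show "x \<otimes> inv y \<in> K" using assms K.mem_carrier by (simp add: m_assoc)
next
  interpret K: subgroup K G by fact
  assume *: "x \<otimes> inv y \<in> K"
  then have "x = (x \<otimes> inv y) \<otimes> y" using assms by (simp add: m_assoc)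
  then have "x \<in> K #> y" using * by (auto simp: r_coset_def)
  then show "K #> x = K #> y" using repr_independence assms by metis
qed

lemma rcos_eq_self_iff:
  assumes "subgroup K G" "x \<in> carrier G"
  shows "K #> x = K \<longleftrightarrow> x \<in> K"
  using rcos_eq_iff[OF assms(1,2) one_closed] assms(2) subgroup.subset[OF assms(1)] by simp

lemma group_hom_Mod:
  assumes "K \<lhd> G"
  shows "group_hom G (G Mod K) (\<lambda>x. K #> x)"
  using assms normal.factorgroup_is_group normal.r_coset_hom_Mod
  by (intro group_hom.intro group_hom_axioms.intro) (auto simp: is_group)

lemma comm_group_Mod:
  assumes K: "subgroup K G" and D: "comm_subgroup G \<subseteq> K"
  shows "comm_group (G Mod K)"
proof (rule group.group_comm_groupI)
  interpret N: normal K G by (rule normal_of_derived_subset[OF K D])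
  show "group (G Mod K)" by (rule N.factorgroup_is_group)
  fix a b assume "a \<in> carrier (G Mod K)" "b \<in> carrier (G Mod K)"
  then obtain x y where x: "x \<in> carrier G" "a = K #> x" and y: "y \<in> carrier G" "b = K #> y"
    by (auto simp: carrier_FactGroup)
  have "x \<otimes> y \<otimes> inv x \<otimes> inv y \<in> K" using x y D commutator_mem_derived by blast
  then have "K #> (x \<otimes> y) = K #> (y \<otimes> x)"
    using x y rcos_eq_iff[OF K, of "x \<otimes> y" "y \<otimes> x"] by (simp add: inv_mult_group m_assoc)
  then show "a \<otimes>\<^bsub>G Mod K\<^esub> b = b \<otimes>\<^bsub>G Mod K\<^esub> a"
    using x y by (simp add: N.rcos_sum)
qed

lemma mem_isolator_iff:
  assumes K: "subgroup K G" and D: "comm_subgroup G \<subseteq> K"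
  shows "x \<in> isolator G K \<longleftrightarrow> x \<in> carrier G \<and> (\<exists>k::nat. k \<ge> 1 \<and> (K #> x) [^]\<^bsub>G Mod K\<^esub> k = \<one>\<^bsub>G Mod K\<^esub>)"
proof -
  interpret N: normal K G by (rule normal_of_derived_subset[OF K D])
  show ?thesis
    by (auto simp: isolator_def N.FactGroup_pow rcos_eq_self_iff[OF K])
qed

lemma subset_isolator:
  assumes "K \<subseteq> carrier G" shows "K \<subseteq> isolator G K"
  using assms by (auto simp: isolator_def intro!: exI[of _ "1::nat"])

text \<open>The isolator is the preimage of the torsion subgroup of the abelian group
  \<open>G Mod K\<close>; exponents \<open>k\<close> and \<open>l\<close> for the factors give
  \<open>k * l\<close> for the product.\<close>

lemma subgroup_isolator:
  assumes K: "subgroup K G" and D: "comm_subgroup G \<subseteq> K"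
  shows "subgroup (isolator G K) G"
proof (rule subgroupI)
  interpret N: normal K G by (rule normal_of_derived_subset[OF K D])
  interpret Q: comm_group "G Mod K" by (rule comm_group_Mod[OF K D])
  interpret h: group_hom G "G Mod K" "\<lambda>x. K #> x" by (rule group_hom_Mod[OF N.normal_axioms])
  show "isolator G K \<subseteq> carrier G" by (auto simp: isolator_def)
  show "isolator G K \<noteq> {}" using subset_isolator[OF N.subset] N.one_closed by blast
  show "inv x \<in> isolator G K" if x: "x \<in> isolator G K" for x
  proof -
    obtain k where "x \<in> carrier G" "k \<ge> 1" "x [^] (k::nat) \<in> K" using x by (auto simp: isolator_def)
    then show ?thesis by (auto simp: isolator_def nat_pow_inv intro!: exI[of _ k])
  qed
  show "x \<otimes> y \<in> isolator G K" if xy: "x \<in> isolator G K" "y \<in> isolator G K" for x y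
  proof -
    obtain k l :: nat where x: "x \<in> carrier G" "k \<ge> 1" "(K #> x) [^]\<^bsub>G Mod K\<^esub> k = \<one>\<^bsub>G Mod K\<^esub>"
      and y: "y \<in> carrier G" "l \<ge> 1" "(K #> y) [^]\<^bsub>G Mod K\<^esub> l = \<one>\<^bsub>G Mod K\<^esub>"
      using xy unfolding mem_isolator_iff[OF K D] by blast
    have c: "K #> x \<in> carrier (G Mod K)" "K #> y \<in> carrier (G Mod K)"
      using x y h.hom_closed by auto
    have "(K #> (x \<otimes> y)) [^]\<^bsub>G Mod K\<^esub> (k * l) =
        ((K #> x) [^]\<^bsub>G Mod K\<^esub> k) [^]\<^bsub>G Mod K\<^esub> l \<otimes>\<^bsub>G Mod K\<^esub> ((K #> y) [^]\<^bsub>G Mod K\<^esub> l) [^]\<^bsub>G Mod K\<^esub> k"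
      using x(1) y(1) c h.hom_mult[of x y] Q.nat_pow_distrib[OF c, of "k * l"]
        Q.nat_pow_pow[OF c(1), of k l] Q.nat_pow_pow[OF c(2), of l k] by (simp only: mult.commute[of l k])
    also have "\<dots> = \<one>\<^bsub>G Mod K\<^esub>" unfolding x(3) y(3) Q.nat_pow_one Q.r_one[OF Q.one_closed] ..
    finally show ?thesis using x y unfolding mem_isolator_iff[OF K D] by (auto intro!: exI[of _ "k * l"])
  qed
qed

lemma isolator_pure:
  assumes x: "x \<in> carrier G" and k: "k \<noteq> (0::int)" and xk: "x [^] k \<in> isolator G K"
    and K: "subgroup K G" "comm_subgroup G \<subseteq> K"
  shows "x \<in> isolator G K"
proof -
  interpret S: subgroup "isolator G K" G by (rule subgroup_isolator[OF K])
  have "x [^] (\<bar>k\<bar>) \<in> isolator G K"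
    using xk x int_pow_neg[of x k] S.m_inv_closed[OF xk] by (auto simp: abs_if)
  moreover have "x [^] (\<bar>k\<bar>) = x [^] nat \<bar>k\<bar>" by (metis int_nat_eq abs_ge_zero int_pow_int)
  ultimately have "x [^] nat \<bar>k\<bar> \<in> isolator G K" by argo
  then obtain l :: nat where "l \<ge> 1" "(x [^] nat \<bar>k\<bar>) [^] l \<in> K" unfolding isolator_def by blast
  then have "x [^] (nat \<bar>k\<bar> * l) \<in> K" "nat \<bar>k\<bar> * l \<ge> 1"
    using k nat_pow_pow[OF x, of "nat \<bar>k\<bar>" l] by auto
  then show ?thesis using x unfolding isolator_def by blast
qed

lemma subgroup_center: "subgroup (center G) G"
proof (rule subgroupI)
  show "center G \<subseteq> carrier G" "center G \<noteq> {}" by (auto simp: center_def)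
  fix x assume x: "x \<in> center G"
  show "inv x \<in> center G"
  proof -
    have "inv x \<otimes> y = y \<otimes> inv x" if y: "y \<in> carrier G" for y
    proof -
      have xc: "x \<in> carrier G" and comm: "x \<otimes> y = y \<otimes> x" using x y by (auto simp: center_def)
      have "inv x \<otimes> y = inv x \<otimes> (y \<otimes> x) \<otimes> inv x" using xc y by (simp add: m_assoc)
      also have "\<dots> = y \<otimes> inv x" using xc y unfolding comm[symmetric] by (simp add: m_assoc[symmetric])
      finally show ?thesis .
    qed
    then show ?thesis using x by (auto simp: center_def)
  qed
  fix y assume y: "y \<in> center G"
  have "x \<otimes> y \<otimes> w = w \<otimes> (x \<otimes> y)" if w: "w \<in> carrier G" for w
  proof -
    have c: "x \<in> carrier G" "y \<in> carrier G" "x \<otimes> w = w \<otimes> x" "y \<otimes> w = w \<otimes> y"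
      using x y w by (auto simp: center_def)
    have "x \<otimes> y \<otimes> w = x \<otimes> w \<otimes> y" using c(1,2,4) w by (simp add: m_assoc)
    also have "\<dots> = w \<otimes> (x \<otimes> y)" unfolding c(3) using c(1,2) w by (simp add: m_assoc)
    finally show ?thesis .
  qed
  then show "x \<otimes> y \<in> center G" using x y unfolding center_def by blast
qed

lemma subgroup_mult_center:
  assumes A: "subgroup A G" and B: "subgroup B G" "B \<subseteq> center G"
  shows "subgroup (A <#> B) G"
proof (rule subgroupI)
  interpret A: subgroup A G by fact
  interpret B: subgroup B G by fact
  have comm: "b \<otimes> x = x \<otimes> b" if "b \<in> B" "x \<in> carrier G" for b x
    using that B(2) by (auto simp: center_def)
  show "A <#> B \<subseteq> carrier G" using A.subset B.subset by (auto simp: set_mult_def)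
  show "A <#> B \<noteq> {}" using A.one_closed B.one_closed unfolding set_mult_def by blast
  show "inv x \<in> A <#> B" if x: "x \<in> A <#> B" for x
  proof -
    obtain a b where ab: "a \<in> A" "b \<in> B" "x = a \<otimes> b" using x by (auto simp: set_mult_def)
    then have "inv x = inv a \<otimes> inv b"
      using comm[of "inv b" "inv a"] A.mem_carrier B.mem_carrier by (simp add: inv_mult_group)
    then show ?thesis using ab by (auto simp: set_mult_def)
  qed
  show "x \<otimes> y \<in> A <#> B" if xy: "x \<in> A <#> B" "y \<in> A <#> B" for x y
  proof -
    obtain a b where ab: "a \<in> A" "b \<in> B" "x = a \<otimes> b" using xy by (auto simp: set_mult_def)
    obtain a' b' where ab': "a' \<in> A" "b' \<in> B" "y = a' \<otimes> b'" using xy by (auto simp: set_mult_def)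
    have c: "a \<in> carrier G" "a' \<in> carrier G" "b \<in> carrier G" "b' \<in> carrier G"
      using ab ab' A.mem_carrier B.mem_carrier by auto
    have "x \<otimes> y = a \<otimes> (b \<otimes> a') \<otimes> b'" using ab ab' c by (simp add: m_assoc)
    also have "\<dots> = (a \<otimes> a') \<otimes> (b \<otimes> b')" unfolding comm[OF ab(2) c(2)] using c by (simp add: m_assoc)
    finally have "x \<otimes> y = (a \<otimes> a') \<otimes> (b \<otimes> b')" .
    then show ?thesis using ab ab' by (auto simp: set_mult_def)
  qed
qed

lemma generate_Mod_image:
  assumes N: "K \<lhd> G" and S: "S \<subseteq> carrier G" "generate G S = carrier G"
  shows "generate (G Mod K) ((\<lambda>x. K #> x) ` S) = carrier (G Mod K)"
proof -
  interpret h: group_hom G "G Mod K" "\<lambda>x. K #> x" by (rule group_hom_Mod[OF N])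
  show ?thesis using h.generate_img[OF S(1)] S(2) by (simp add: carrier_FactGroup)
qed

text \<open>The abelian splitting is applied in \<open>G Mod I\<close>, and the complement is pulled
  back to \<open>G\<close>.\<close>

lemma ex_complement_over:
  assumes I: "subgroup I G" "comm_subgroup G \<subseteq> I"
    and M: "subgroup M G" "I \<subseteq> M" and F: "subgroup F G" "I \<subseteq> F"
    and FM: "F <#> M = carrier G"
    and pure: "\<And>x k. x \<in> carrier G \<Longrightarrow> k \<noteq> (0::int) \<Longrightarrow> x [^] k \<in> M \<Longrightarrow> x \<in> M"
    and S: "finite S" "S \<subseteq> carrier G" "generate G S = carrier G"
  shows "\<exists>C. subgroup C G \<and> I \<subseteq> C \<and> C \<subseteq> F \<and> C \<inter> M = I \<and> C <#> M = carrier G"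
proof -
  interpret N: normal I G by (rule normal_of_derived_subset[OF I])
  interpret Q: comm_group "G Mod I" by (rule comm_group_Mod[OF I])
  interpret h: group_hom G "G Mod I" "\<lambda>x. I #> x" by (rule group_hom_Mod[OF N.normal_axioms])
  interpret M: subgroup M G by (fact M)
  interpret F: subgroup F G by (fact F)
  let ?q = "\<lambda>x. I #> x"
  \<comment> \<open>Subgroups containing \<open>I\<close> are unions of cosets of \<open>I\<close>,
    so membership can be tested in the quotient.\<close>
  have sat: "x \<in> K" if K: "?q x \<in> ?q ` K" "x \<in> carrier G" "subgroup K G" "I \<subseteq> K" for x K
  proof -
    interpret K: subgroup K G by fact
    obtain y where y: "y \<in> K" "?q x = ?q y" using K(1) by auto
    then have "x \<otimes> inv y \<in> I" using rcos_eq_iff[OF I(1) that(2), of y] by auto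
    then have "x \<otimes> inv y \<otimes> y \<in> K" using that(4) y by auto
    then show ?thesis using that(2) y by (simp add: m_assoc)
  qed
  have "?q ` F <#>\<^bsub>G Mod I\<^esub> ?q ` M = carrier (G Mod I)"
  proof -
    have "?q ` F <#>\<^bsub>G Mod I\<^esub> ?q ` M = ?q ` (F <#> M)"
    proof -
      have "(\<Union>f\<in>F. \<Union>m\<in>M. {?q f \<otimes>\<^bsub>G Mod I\<^esub> ?q m}) = (\<Union>f\<in>F. \<Union>m\<in>M. {?q (f \<otimes> m)})"
        by (intro SUP_cong refl) (use h.hom_mult F.mem_carrier M.mem_carrier in simp)
      then show ?thesis unfolding set_mult_def by (simp only: image_UN image_insert image_empty SUP_image o_def)
    qed
    then show ?thesis unfolding FM by (simp add: carrier_FactGroup)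
  qed
  moreover have "x \<in> ?q ` M"
    if x: "x \<in> carrier (G Mod I)" and k: "k \<noteq> (0::int)" and xk: "x [^]\<^bsub>G Mod I\<^esub> k \<in> ?q ` M" for x k
  proof -
    obtain g where g: "g \<in> carrier G" "x = ?q g" using x by (auto simp: carrier_FactGroup)
    have "?q (g [^] k) \<in> ?q ` M" using xk g by (simp add: N.FactGroup_int_pow)
    from sat[OF this int_pow_closed[OF g(1)] M] have "g \<in> M" by (rule pure[OF g(1) k])
    then show ?thesis using g(2) by blast
  qed
  moreover have "finite (?q ` S)" "?q ` S \<subseteq> carrier (G Mod I)"
    using S h.hom_closed by auto
  ultimately have "\<exists>C'. subgroup C' (G Mod I) \<and> C' \<subseteq> ?q ` F \<and> C' \<inter> ?q ` M = {\<one>\<^bsub>G Mod I\<^esub>} \<and>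
      C' <#>\<^bsub>G Mod I\<^esub> ?q ` M = carrier (G Mod I)"
    by (intro Q.pure_subgroup_complement[where S = "?q ` S"] h.subgroup_img_is_subgroup M(1) F(1)
        generate_Mod_image[OF N.normal_axioms S(2,3)])
  then obtain C' where "subgroup C' (G Mod I) \<and> C' \<subseteq> ?q ` F \<and> C' \<inter> ?q ` M = {\<one>\<^bsub>G Mod I\<^esub>} \<and>
      C' <#>\<^bsub>G Mod I\<^esub> ?q ` M = carrier (G Mod I)" ..
  then have C': "subgroup C' (G Mod I)" "C' \<subseteq> ?q ` F" "C' \<inter> ?q ` M = {\<one>\<^bsub>G Mod I\<^esub>}"
    "C' <#>\<^bsub>G Mod I\<^esub> ?q ` M = carrier (G Mod I)" by simp_all
  interpret C': subgroup C' "G Mod I" by (fact C')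
  define C where "C = {x \<in> carrier G. ?q x \<in> C'}"
  have "subgroup C G"
  proof (rule subgroupI)
    show "C \<subseteq> carrier G" by (auto simp: C_def)
    have "\<one> \<in> C" using C'.one_closed h.hom_one unfolding C_def by simp
    then show "C \<noteq> {}" by blast
    show "inv x \<in> C" if "x \<in> C" for x
      using that C'.m_inv_closed[of "?q x"] h.hom_inv[of x] unfolding C_def by simp
    show "x \<otimes> y \<in> C" if "x \<in> C" "y \<in> C" for x y
      using that C'.m_closed[of "?q x" "?q y"] h.hom_mult[of x y] unfolding C_def by simp
  qed
  moreover have "I \<subseteq> C"
  proof
    fix x assume x: "x \<in> I"
    then have "x \<in> carrier G" "?q x = I" using N.subset rcos_eq_self_iff[OF I(1)] by blast+
    then show "x \<in> C" using C'.one_closed by (simp add: C_def)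
  qed
  moreover have "C \<subseteq> F"
  proof
    fix x assume "x \<in> C"
    then have "x \<in> carrier G" "?q x \<in> ?q ` F" using C'(2) by (auto simp: C_def)
    then show "x \<in> F" using sat[OF _ _ F] by blast
  qed
  moreover have "C \<inter> M = I"
  proof -
    have "x \<in> I" if "x \<in> C" "x \<in> M" for x
    proof -
      have "?q x = I" "x \<in> carrier G" using that C'(3) by (auto simp: C_def)
      then show ?thesis using rcos_eq_self_iff[OF I(1)] by blast
    qed
    then show ?thesis using \<open>I \<subseteq> C\<close> M(2) by blast
  qed
  moreover have "C <#> M = carrier G"
  proof
    show "C <#> M \<subseteq> carrier G" using M.subset by (auto simp: set_mult_def C_def)
    show "carrier G \<subseteq> C <#> M"
    proof
      fix x assume x: "x \<in> carrier G"
      then have "?q x \<in> C' <#>\<^bsub>G Mod I\<^esub> ?q ` M" unfolding C'(4) by simp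
      then obtain a m where a: "a \<in> C'" "m \<in> M" "?q x = a \<otimes>\<^bsub>G Mod I\<^esub> ?q m" by (auto simp: set_mult_def)
      have c: "?q x \<in> carrier (G Mod I)" "?q m \<in> carrier (G Mod I)" "m \<in> carrier G"
        using h.hom_closed x M.mem_carrier[OF a(2)] by auto
      then have "?q x \<otimes>\<^bsub>G Mod I\<^esub> inv\<^bsub>G Mod I\<^esub> ?q m = a"
        using a(3) C'.mem_carrier[OF a(1)] Q.inv_solve_right' by blast
      then have "?q (x \<otimes> inv m) = a" using x c(3) h.hom_mult[of x "inv m"] h.hom_inv[of m] by simp
      then have "x \<otimes> inv m \<in> C" using a x by (simp add: C_def)
      moreover have "x = x \<otimes> inv m \<otimes> m" using a x by (simp add: m_assoc)
      ultimately show "x \<in> C <#> M" using a by (auto simp: set_mult_def)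
    qed
  qed
  ultimately show ?thesis by blast
qed

end

section \<open>Lattice coordinates on the group\<close>

context group
begin

lemma gprod_0 [simp]: "gprod G x 0 = \<one>"
  by (simp add: gprod_def)

lemma gprod_Suc:
  assumes "\<And>i. i \<le> m \<Longrightarrow> x i \<in> carrier G"
  shows "gprod G x (Suc m) = gprod G x m \<otimes> x m"
proof -
  have *: "foldr (\<lambda>i acc. x i \<otimes> acc) xs a = foldr (\<lambda>i acc. x i \<otimes> acc) xs \<one> \<otimes> a \<and>
      foldr (\<lambda>i acc. x i \<otimes> acc) xs \<one> \<in> carrier G"
    if "a \<in> carrier G" "set xs \<subseteq> {..m}" for xs a
    using that assms by (induction xs) (auto simp: m_assoc)
  have "set [0..<m] \<subseteq> {..m}" by auto
  then show ?thesis using *[of "x m" "[0..<m]"] assms[of m] by (simp add: gprod_def)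
qed

lemma gprod_mem:
  assumes "subgroup K G" "\<And>i. i < m \<Longrightarrow> x i \<in> K"
  shows "gprod G x m \<in> K"
  using assms(2)
proof (induction m)
  case 0
  then show ?case using assms(1) by (simp add: subgroup.one_closed)
next
  case (Suc m)
  interpret K: subgroup K G by fact
  have "gprod G x (Suc m) = gprod G x m \<otimes> x m" using Suc.prems by (intro gprod_Suc) auto
  then show ?case using Suc by simp
qed

lemma gprod_closed: "(\<And>i. i < m \<Longrightarrow> x i \<in> carrier G) \<Longrightarrow> gprod G x m \<in> carrier G"
  by (rule gprod_mem[OF subgroup_self])

lemma additive_gprod:
  fixes f :: "'a \<Rightarrow> int"
  assumes f: "\<And>a b. a \<in> carrier G \<Longrightarrow> b \<in> carrier G \<Longrightarrow> f (a \<otimes> b) = f a + f b"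
    and "\<And>i. i < m \<Longrightarrow> x i \<in> carrier G"
  shows "f (gprod G x m) = (\<Sum>i<m. f (x i))"
  using assms(2)
proof (induction m)
  case 0
  then show ?case using f[of \<one> \<one>] by simp
next
  case (Suc m)
  have "gprod G x (Suc m) = gprod G x m \<otimes> x m" using Suc.prems by (intro gprod_Suc) auto
  then show ?case using Suc f[of "gprod G x m" "x m"] gprod_closed[of m x] by simp
qed

lemma additive_inv:
  fixes f :: "'a \<Rightarrow> int"
  assumes f: "\<And>a b. a \<in> carrier G \<Longrightarrow> b \<in> carrier G \<Longrightarrow> f (a \<otimes> b) = f a + f b" and x: "x \<in> carrier G"
  shows "f (inv x) = - f x"
  using f[of \<one> \<one>] f[of "inv x" x] x by simp

lemma additive_nat_pow:
  fixes f :: "'a \<Rightarrow> int"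
  assumes f: "\<And>a b. a \<in> carrier G \<Longrightarrow> b \<in> carrier G \<Longrightarrow> f (a \<otimes> b) = f a + f b" and x: "x \<in> carrier G"
  shows "f (x [^] (k::nat)) = int k * f x"
proof (induction k)
  case 0
  show ?case using f[of \<one> \<one>] by simp
next
  case (Suc k)
  have "f (x [^] Suc k) = f (x [^] k) + f x"
    unfolding nat_pow_Suc by (rule f[OF nat_pow_closed[OF x] x])
  then show ?case unfolding Suc by (simp add: distrib_right)
qed

lemma additive_int_pow:
  fixes f :: "'a \<Rightarrow> int"
  assumes f: "\<And>a b. a \<in> carrier G \<Longrightarrow> b \<in> carrier G \<Longrightarrow> f (a \<otimes> b) = f a + f b" and x: "x \<in> carrier G"
  shows "f (x [^] (k::int)) = k * f x"
proof (cases "k \<ge> 0")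
  case True
  then have "x [^] k = x [^] nat k" by simp
  then show ?thesis using True additive_nat_pow[where f = f, OF f x, of "nat k"] by simp
next
  case False
  then have "x [^] k = inv (x [^] nat (- k))" unfolding int_pow_def2[of G x k] by simp
  moreover have "f (inv (x [^] nat (- k))) = - f (x [^] nat (- k))"
    by (rule additive_inv[where f = f, OF f nat_pow_closed[OF x]])
  ultimately show ?thesis using False additive_nat_pow[where f = f, OF f x, of "nat (- k)"] by simp
qed

text \<open>Ordered products are awkward in a nonabelian group; the computations with
  \<open>zpow\<close> and \<open>upow\<close> are done after passing to an abelian quotient, where
  the order disappears.\<close>

lemma hom_gprod:
  assumes Q: "comm_group Q" and h: "group_hom G Q h" and x: "\<And>i. i < m \<Longrightarrow> x i \<in> carrier G"
  shows "h (gprod G x m) = (\<Otimes>\<^bsub>Q\<^esub>i\<in>{..<m}. h (x i))"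
  using x
proof (induction m)
  interpret Q: comm_group Q by fact
  interpret h: group_hom G Q h by fact
  case 0
  show ?case by simp
next
  interpret Q: comm_group Q by fact
  interpret h: group_hom G Q h by fact
  case (Suc m)
  have "gprod G x (Suc m) = gprod G x m \<otimes> x m" using Suc.prems by (intro gprod_Suc) auto
  moreover have "(\<Otimes>\<^bsub>Q\<^esub>i\<in>{..<Suc m}. h (x i)) = h (x m) \<otimes>\<^bsub>Q\<^esub> (\<Otimes>\<^bsub>Q\<^esub>i\<in>{..<m}. h (x i))"
    unfolding lessThan_Suc using Suc.prems by (intro Q.finprod_insert) auto
  moreover have "(\<Otimes>\<^bsub>Q\<^esub>i\<in>{..<m}. h (x i)) \<in> carrier Q"
    using Suc.prems by (intro Q.finprod_closed) auto
  ultimately show ?case using Suc gprod_closed[of m x] by (simp add: Q.m_comm)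
qed

lemma mem_rcos_iff:
  assumes "subgroup K G" "x \<in> carrier G" "y \<in> carrier G"
  shows "x \<in> K #> y \<longleftrightarrow> K #> x = K #> y"
  using assms repr_independence[of x K y] rcos_self[of x K] by metis

end

text \<open>\<open>Fc\<close> is the preimage of a complement of M(G)/N(G) in G/N(G). Projecting
  along it turns a cocycle on M(G)/N(G) into one on G/N(G).\<close>

locale addition_setting = group G for G :: "('a, 'b) monoid_scheme" (structure) +
  fixes G0 Fc :: "'a set" and p n :: nat and z u :: "nat \<Rightarrow> 'a" and e :: "nat \<Rightarrow> nat"
  assumes fg: "fin_gen_group G"
    and add: "addition G G0"
    and z_in: "\<And>k. k < p \<Longrightarrow> z k \<in> G0"
    and z_basis: "bij_betw (\<lambda>a. gprod G (\<lambda>k. z k [^] a k) p) {a :: nat \<Rightarrow> int. \<forall>k\<ge>p. a k = 0} G0"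
    and n_le_p: "n \<le> p"
    and u_in: "\<And>i. i < n \<Longrightarrow> u i \<in> MG G"
    and e_gt: "\<And>i. i < n \<Longrightarrow> e i > 1"
    and u_dec: "bij_betw (\<lambda>s. NG G #> gprod G (\<lambda>i. u i [^] s i) n)
                  (exp_box e n) {NG G #> m | m. m \<in> MG G}"
    and u_pow: "\<And>i. i < n \<Longrightarrow> \<exists>y \<in> isolator G (comm_subgroup G). u i [^] e i = z i \<otimes> y"
    and Fc_sub: "subgroup Fc G"
    and Fc_N: "NG G \<subseteq> Fc"
    and Fc_cap: "Fc \<inter> MG G = NG G"
    and Fc_prod: "Fc <#> MG G = carrier G"
begin

abbreviation (input) isoD :: "'a set" where "isoD \<equiv> isolator G (comm_subgroup G)"

lemma subgroup_derived: "subgroup (comm_subgroup G) G"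
  by (rule derived_is_subgroup) simp

lemma subgroup_isoD: "subgroup isoD G" and derived_isoD: "comm_subgroup G \<subseteq> isoD"
  using subgroup_isolator[OF subgroup_derived order_refl]
    subset_isolator[OF subgroup.subset[OF subgroup_derived]] by auto

lemma G0_sub: "subgroup G0 G" and G0_center: "G0 \<subseteq> center G"
  and G0_IG: "G0 \<inter> IG G = {\<one>}" and G0_prod: "G0 <#> IG G = center G"
  using add by (auto simp: addition_def)

lemma G0_carrier: "g \<in> G0 \<Longrightarrow> g \<in> carrier G"
  using subgroup.mem_carrier[OF G0_sub] .

lemma G0_comm: "g \<in> G0 \<Longrightarrow> x \<in> carrier G \<Longrightarrow> g \<otimes> x = x \<otimes> g"
  using G0_center by (auto simp: center_def)

lemma NG_sub: "subgroup (NG G) G"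
  unfolding NG_def by (rule subgroup_mult_center[OF subgroup_isoD subgroup_center order_refl])

lemma isoD_NG: "isoD \<subseteq> NG G" and center_NG: "center G \<subseteq> NG G"
proof -
  have c: "isoD \<subseteq> carrier G" "center G \<subseteq> carrier G" "\<one> \<in> isoD" "\<one> \<in> center G"
    using subgroup_isoD subgroup_center by (auto dest: subgroup.subset subgroup.one_closed)
  show "isoD \<subseteq> NG G"
  proof
    fix x assume "x \<in> isoD"
    moreover have "x = x \<otimes> \<one>" using calculation c by auto
    ultimately show "x \<in> NG G" unfolding NG_def set_mult_def using c by blast
  qed
  show "center G \<subseteq> NG G"
  proof
    fix x assume "x \<in> center G"
    moreover have "x = \<one> \<otimes> x" using calculation c by auto
    ultimately show "x \<in> NG G" unfolding NG_def set_mult_def using c by blast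
  qed
qed

lemma derived_center:
  "subgroup (comm_subgroup G <#> center G) G" "comm_subgroup G \<subseteq> comm_subgroup G <#> center G"
proof -
  show "subgroup (comm_subgroup G <#> center G) G"
    by (rule subgroup_mult_center[OF subgroup_derived subgroup_center order_refl])
  show "comm_subgroup G \<subseteq> comm_subgroup G <#> center G"
  proof
    fix x assume x: "x \<in> comm_subgroup G"
    then have "x = x \<otimes> \<one>" using subgroup.mem_carrier[OF subgroup_derived] by simp
    then show "x \<in> comm_subgroup G <#> center G"
      unfolding set_mult_def using x subgroup.one_closed[OF subgroup_center] by blast
  qed
qed

lemma MG_sub: "subgroup (MG G) G"
  unfolding MG_def by (rule subgroup_isolator[OF derived_center])

lemma MG_pure:
  assumes "x \<in> carrier G" "k \<noteq> (0::int)" "x [^] k \<in> MG G"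
  shows "x \<in> MG G"
  using assms isolator_pure[OF _ _ _ derived_center] unfolding MG_def by blast

lemma NG_MG: "NG G \<subseteq> MG G"
proof
  fix x assume "x \<in> NG G"
  then obtain a b where ab: "a \<in> isoD" "b \<in> center G" "x = a \<otimes> b" by (auto simp: NG_def set_mult_def)
  then obtain k :: nat where k: "a \<in> carrier G" "k \<ge> 1" "a [^] k \<in> comm_subgroup G"
    by (auto simp: isolator_def)
  have b: "b \<in> carrier G" "a \<otimes> b = b \<otimes> a" using ab(2) k(1) by (auto simp: center_def)
  have "x [^] k = a [^] k \<otimes> b [^] k" unfolding ab(3) by (rule pow_mult_distrib[OF b(2) k(1) b(1)])
  moreover have "b [^] k \<in> center G"
    using ab(2) subgroup_int_pow_closed[OF subgroup_center, of b "int k"] by (simp add: int_pow_int)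
  ultimately have "x [^] k \<in> comm_subgroup G <#> center G" using k unfolding set_mult_def by blast
  then show "x \<in> MG G" unfolding MG_def isolator_def using k b ab by auto
qed

lemma isoD_Fc: "isoD \<subseteq> Fc" and derived_Fc: "comm_subgroup G \<subseteq> Fc" and G0_Fc: "G0 \<subseteq> Fc"
  using isoD_NG Fc_N derived_isoD center_NG G0_center by blast+

lemma NG_decomp:
  assumes "x \<in> NG G" shows "\<exists>a\<in>isoD. \<exists>g\<in>G0. x = a \<otimes> g"
proof -
  interpret D: subgroup isoD G by (rule subgroup_isoD)
  obtain a b where ab: "a \<in> isoD" "b \<in> center G" "x = a \<otimes> b" using assms by (auto simp: NG_def set_mult_def)
  then have "b \<in> G0 <#> IG G" unfolding G0_prod by simp
  then obtain g i where gi: "g \<in> G0" "i \<in> IG G" "b = g \<otimes> i" unfolding set_mult_def by blast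
  have i: "i \<in> isoD" "i \<in> carrier G" using gi(2) by (auto simp: IG_def center_def)
  have "x = (a \<otimes> i) \<otimes> g"
    using ab gi i G0_comm[of g i] G0_carrier[of g] D.mem_carrier[of a] by (simp add: m_assoc)
  then show ?thesis using gi i ab by blast
qed

text \<open>\<open>MG G\<close> is an isolator, so the quotient by it has no torsion and splits off.
  Working over \<open>isoD\<close> makes the complement normal with abelian quotient.\<close>

lemma ex_free_complement:
  "\<exists>C. subgroup C G \<and> isoD \<subseteq> C \<and> C \<subseteq> Fc \<and> C \<inter> MG G = isoD \<and> C <#> MG G = carrier G"
proof -
  obtain S where S: "finite S" "S \<subseteq> carrier G" "generate G S = carrier G"
    using fg by (auto simp: fin_gen_group_def)
  have "isoD \<subseteq> MG G" using isoD_NG NG_MG by blast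
  then show ?thesis
    by (rule ex_complement_over[OF subgroup_isoD derived_isoD MG_sub _ Fc_sub isoD_Fc Fc_prod MG_pure S])
qed

definition compl :: "'a set" where
  "compl = (SOME C. subgroup C G \<and> isoD \<subseteq> C \<and> C \<subseteq> Fc \<and> C \<inter> MG G = isoD \<and> C <#> MG G = carrier G)"

lemma compl: "subgroup compl G" "isoD \<subseteq> compl" "compl \<subseteq> Fc" "compl \<inter> MG G = isoD"
    "compl <#> MG G = carrier G" "comm_subgroup G \<subseteq> compl"
  using someI_ex[OF ex_free_complement] derived_isoD unfolding compl_def by blast+

text \<open>Central elements lie in \<open>MG G\<close>, so \<open>x\<close> lies in
  \<open>isoD\<close> and in the centre, that is, in \<open>IG G\<close>, which \<open>G0\<close>
  meets trivially.\<close>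

lemma compl_G0:
  assumes "x \<in> compl" "x \<in> G0" shows "x = \<one>"
proof -
  have "x \<in> center G" "x \<in> isoD" using assms G0_center center_NG NG_MG compl(4) by blast+
  then show ?thesis using assms G0_IG unfolding IG_def by blast
qed

text \<open>In \<open>x = h \<otimes> m\<close> the factor \<open>m\<close> lies in
  \<open>Fc \<inter> MG G = NG G\<close>, hence in \<open>isoD <#> G0\<close>, and its part in
  \<open>isoD\<close> is absorbed by \<open>compl\<close>.\<close>

lemma Fc_decomp:
  assumes x: "x \<in> Fc" shows "\<exists>h\<in>compl. \<exists>g\<in>G0. x = h \<otimes> g"
proof -
  interpret C: subgroup compl G by (rule compl)
  interpret F: subgroup Fc G by (rule Fc_sub)
  interpret M: subgroup "MG G" G by (rule MG_sub)
  have "x \<in> compl <#> MG G" unfolding compl(5) using x by simp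
  then obtain h m where hm: "h \<in> compl" "m \<in> MG G" "x = h \<otimes> m" by (auto simp: set_mult_def)
  then have m: "m = inv h \<otimes> x" by (simp add: m_assoc[symmetric])
  have "inv h \<in> Fc" using hm(1) compl(3) by auto
  then have "m \<in> Fc" unfolding m using x by (rule F.m_closed)
  then have "m \<in> NG G" using hm Fc_cap by blast
  then obtain a g where ag: "a \<in> isoD" "g \<in> G0" "m = a \<otimes> g" using NG_decomp by blast
  have "a \<in> compl" using ag(1) compl(2) by blast
  moreover have "x = (h \<otimes> a) \<otimes> g" using hm ag \<open>a \<in> compl\<close> G0_carrier by (simp add: m_assoc)
  ultimately show ?thesis using hm ag by blast
qed

section \<open>Coordinates on \<open>G0\<close>, seen in G/compl, and on the finite quotient
  G/Fc\<close>

abbreviation (input) QC where "QC \<equiv> G Mod compl"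
abbreviation (input) qC where "qC x \<equiv> compl #> x"
abbreviation (input) QF where "QF \<equiv> G Mod Fc"
abbreviation (input) qF where "qF x \<equiv> Fc #> x"

lemma QC: "comm_group QC" "group_hom G QC (\<lambda>x. qC x)"
  using comm_group_Mod[OF compl(1,6)] group_hom_Mod[OF normal_of_derived_subset[OF compl(1,6)]] by auto

lemma QF: "comm_group QF" "group_hom G QF (\<lambda>x. qF x)"
  using comm_group_Mod[OF Fc_sub derived_Fc] group_hom_Mod[OF normal_of_derived_subset[OF Fc_sub derived_Fc]] by auto

lemma qC_inj:
  assumes "g \<in> G0" "h \<in> G0" "qC g = qC h" shows "g = h"
proof -
  interpret G0: subgroup G0 G by (rule G0_sub)
  have "g \<otimes> inv h \<in> compl" using assms rcos_eq_iff[OF compl(1)] G0.mem_carrier by blast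
  then have "g \<otimes> inv h = \<one>" using compl_G0 assms G0.m_closed G0.m_inv_closed by blast
  then show ?thesis using assms G0.mem_carrier inv_solve_right'[of \<one> g h] by auto
qed

definition vec :: "(nat \<Rightarrow> int) \<Rightarrow> bool" where
  "vec a \<longleftrightarrow> (\<forall>k\<ge>p. a k = 0)"

definition zpow :: "(nat \<Rightarrow> int) \<Rightarrow> 'a" where
  "zpow a = gprod G (\<lambda>k. z k [^] a k) p"

lemma zpow_mem: "zpow a \<in> G0"
  unfolding zpow_def by (rule gprod_mem[OF G0_sub]) (use z_in subgroup_int_pow_closed[OF G0_sub] in auto)

lemma zpow_carrier: "zpow a \<in> carrier G"
  using zpow_mem G0_carrier by blast

lemma ex_zpow: "g \<in> G0 \<Longrightarrow> \<exists>a. vec a \<and> g = zpow a"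
  using z_basis unfolding bij_betw_def zpow_def vec_def by blast

lemma zpow_inj: "vec a \<Longrightarrow> vec b \<Longrightarrow> zpow a = zpow b \<Longrightarrow> a = b"
  using z_basis unfolding bij_betw_def zpow_def vec_def inj_on_def by blast

lemma qC_zpow: "qC (zpow a) = (\<Otimes>\<^bsub>QC\<^esub>k\<in>{..<p}. qC (z k) [^]\<^bsub>QC\<^esub> a k)"
proof -
  interpret Q: comm_group QC by (rule QC)
  interpret h: group_hom G QC "\<lambda>x. qC x" by (rule QC)
  have "qC (zpow a) = (\<Otimes>\<^bsub>QC\<^esub>k\<in>{..<p}. qC (z k [^] a k))"
    unfolding zpow_def by (rule hom_gprod[OF QC]) (use z_in G0_carrier in auto)
  also have "\<dots> = (\<Otimes>\<^bsub>QC\<^esub>k\<in>{..<p}. qC (z k) [^]\<^bsub>QC\<^esub> a k)"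
    using z_in G0_carrier by (intro Q.finprod_cong') (auto simp: h.hom_int_pow Pi_iff)
  finally show ?thesis .
qed

text \<open>Computed in the abelian quotient by \<open>compl\<close>, into which \<open>G0\<close>
  embeds.\<close>

lemma zpow_add: "zpow (\<lambda>k. a k + b k) = zpow a \<otimes> zpow b"
proof (rule qC_inj[OF zpow_mem])
  interpret Q: comm_group QC by (rule QC)
  interpret h: group_hom G QC "\<lambda>x. qC x" by (rule QC)
  show "zpow a \<otimes> zpow b \<in> G0" using zpow_mem subgroup.m_closed[OF G0_sub] by blast
  have "(\<lambda>k. qC (z k)) \<in> {..<p} \<rightarrow> carrier QC" using z_in G0_carrier h.hom_closed by auto
  then have "qC (zpow (\<lambda>k. a k + b k)) = qC (zpow a) \<otimes>\<^bsub>QC\<^esub> qC (zpow b)"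
    unfolding qC_zpow by (rule Q.finprod_int_pow_add)
  also have "\<dots> = qC (zpow a \<otimes> zpow b)" using h.hom_mult[OF zpow_carrier zpow_carrier] by simp
  finally show "qC (zpow (\<lambda>k. a k + b k)) = qC (zpow a \<otimes> zpow b)" .
qed

lemma zpow_0: "zpow (\<lambda>k. 0) = \<one>"
  using zpow_add[of "\<lambda>k. 0" "\<lambda>k. 0"] zpow_carrier[of "\<lambda>k. 0"] l_cancel_one' by fastforce

lemma zpow_mult: "zpow (\<lambda>k. int m * a k) = zpow a [^] m"
proof (induction m)
  case (Suc m)
  have "zpow (\<lambda>k. int (Suc m) * a k) = zpow (\<lambda>k. int m * a k + a k)" by (simp add: algebra_simps)
  then show ?case unfolding zpow_add Suc by simp
qed (simp add: zpow_0)

lemma zpow_unit: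
  assumes k: "k < p" shows "z k = zpow (\<lambda>j. if j = k then 1 else 0)"
proof (rule qC_inj[OF z_in[OF k] zpow_mem])
  interpret Q: comm_group QC by (rule QC)
  interpret h: group_hom G QC "\<lambda>x. qC x" by (rule QC)
  have c: "(\<lambda>k. qC (z k)) \<in> {..<p} \<rightarrow> carrier QC" using z_in G0_carrier h.hom_closed by auto
  have "qC (zpow (\<lambda>j. if j = k then 1 else 0)) = (\<Otimes>\<^bsub>QC\<^esub>j\<in>{..<p}. if k = j then qC (z j) else \<one>\<^bsub>QC\<^esub>)"
    unfolding qC_zpow using c Q.one_closed by (intro Q.finprod_cong') (auto simp: Pi_iff)
  also have "\<dots> = qC (z k)" using k c by (intro Q.finprod_singleton) auto
  finally show "qC (z k) = qC (zpow (\<lambda>j. if j = k then 1 else 0))" by simp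
qed

definition upow :: "(nat \<Rightarrow> nat) \<Rightarrow> 'a" where
  "upow s = gprod G (\<lambda>i. u i [^] s i) n"

lemma u_carrier: "i < n \<Longrightarrow> u i \<in> carrier G"
  using u_in subgroup.mem_carrier[OF MG_sub] by blast

lemma upow_mem: "upow s \<in> MG G"
proof -
  have "u i [^] s i \<in> MG G" if "i < n" for i
    using subgroup_int_pow_closed[OF MG_sub u_in[OF that], of "int (s i)"] by (simp add: int_pow_int)
  then show ?thesis unfolding upow_def by (rule gprod_mem[OF MG_sub])
qed

lemma upow_carrier: "upow s \<in> carrier G"
  using upow_mem subgroup.mem_carrier[OF MG_sub] by blast

lemma qF_upow: "qF (upow s) = (\<Otimes>\<^bsub>QF\<^esub>i\<in>{..<n}. qF (u i) [^]\<^bsub>QF\<^esub> s i)"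
proof -
  interpret Q: comm_group QF by (rule QF)
  interpret h: group_hom G QF "\<lambda>x. qF x" by (rule QF)
  have "qF (upow s) = (\<Otimes>\<^bsub>QF\<^esub>i\<in>{..<n}. qF (u i [^] s i))"
    unfolding upow_def by (rule hom_gprod[OF QF]) (use u_carrier in auto)
  also have "\<dots> = (\<Otimes>\<^bsub>QF\<^esub>i\<in>{..<n}. qF (u i) [^]\<^bsub>QF\<^esub> s i)"
    using u_carrier by (intro Q.finprod_cong') (auto simp: h.hom_nat_pow Pi_iff)
  finally show ?thesis .
qed

lemma qF_u_pow:
  assumes i: "i < n" shows "qF (u i) [^]\<^bsub>QF\<^esub> e i = \<one>\<^bsub>QF\<^esub>"
proof -
  interpret h: group_hom G QF "\<lambda>x. qF x" by (rule QF)
  interpret F: subgroup Fc G by (rule Fc_sub)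
  obtain y where y: "y \<in> isoD" "u i [^] e i = z i \<otimes> y" using u_pow[OF i] by blast
  have "z i \<in> Fc" "y \<in> Fc" using z_in[of i] i n_le_p G0_Fc y isoD_Fc by auto
  then have "u i [^] e i \<in> Fc" using y by simp
  then have "qF (u i [^] e i) = \<one>\<^bsub>QF\<^esub>" using rcos_eq_self_iff[OF Fc_sub] by simp
  then show ?thesis using h.hom_nat_pow[OF u_carrier[OF i], of "e i"] by argo
qed

text \<open>Representatives of M(G)/N(G) stay distinct modulo \<open>Fc\<close> because
  \<open>Fc \<inter> MG G = NG G\<close>; with \<open>ex_upow\<close> this makes G/Fc a copy of
  M(G)/N(G).\<close>

lemma upow_inj:
  assumes "s \<in> exp_box e n" "t \<in> exp_box e n" "qF (upow s) = qF (upow t)"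
  shows "s = t"
proof -
  interpret M: subgroup "MG G" G by (rule MG_sub)
  have "upow s \<otimes> inv upow t \<in> Fc" using assms(3) rcos_eq_iff[OF Fc_sub upow_carrier upow_carrier] by blast
  moreover have "upow s \<otimes> inv upow t \<in> MG G" using upow_mem by blast
  ultimately have "upow s \<otimes> inv upow t \<in> NG G" using Fc_cap by blast
  then have "NG G #> upow s = NG G #> upow t" using rcos_eq_iff[OF NG_sub upow_carrier upow_carrier] by blast
  then show ?thesis using assms(1,2) u_dec unfolding bij_betw_def inj_on_def upow_def by blast
qed

lemma ex_upow:
  assumes x: "x \<in> carrier G"
  shows "\<exists>s\<in>exp_box e n. qF x = qF (upow s)"
proof -
  interpret Q: comm_group QF by (rule QF)
  interpret h: group_hom G QF "\<lambda>x. qF x" by (rule QF)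
  obtain f m where fm: "f \<in> Fc" "m \<in> MG G" "x = f \<otimes> m"
    using x unfolding Fc_prod[symmetric] set_mult_def by blast
  have c: "f \<in> carrier G" "m \<in> carrier G"
    using fm subgroup.mem_carrier[OF Fc_sub] subgroup.mem_carrier[OF MG_sub] by auto
  have "NG G #> m \<in> (\<lambda>s. NG G #> upow s) ` exp_box e n"
    using u_dec fm(2) unfolding bij_betw_def upow_def by blast
  then obtain s where s: "s \<in> exp_box e n" "NG G #> m = NG G #> upow s" by blast
  then have "m \<otimes> inv upow s \<in> Fc" using Fc_N rcos_eq_iff[OF NG_sub c(2) upow_carrier] by blast
  then have "qF m = qF (upow s)" using rcos_eq_iff[OF Fc_sub c(2) upow_carrier] by blast
  moreover have "qF f = \<one>\<^bsub>QF\<^esub>" using fm(1) c rcos_eq_self_iff[OF Fc_sub] by simp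
  then have "qF x = qF m" using fm(3) h.hom_mult[OF c] Q.l_one[OF h.hom_closed[OF c(2)]] by argo
  ultimately show ?thesis using s by auto
qed

abbreviation tc :: "'a \<Rightarrow> nat \<Rightarrow> nat" where "tc \<equiv> tcoord G Fc u e n"

lemma tc_eqI:
  assumes "x \<in> carrier G" "s \<in> exp_box e n" "qF x = qF (upow s)"
  shows "tc x = s"
  unfolding tcoord_def upow_def[symmetric] mem_rcos_iff[OF Fc_sub assms(1) upow_carrier]
  by (rule the_equality) (use assms upow_inj in auto)

lemma tc: 
  assumes "x \<in> carrier G"
  shows "tc x \<in> exp_box e n" "qF x = qF (upow (tc x))"
proof -
  obtain s where s: "s \<in> exp_box e n" "qF x = qF (upow s)" using ex_upow[OF assms] by blast
  with tc_eqI[OF assms s] show "tc x \<in> exp_box e n" "qF x = qF (upow (tc x))" by auto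
qed

lemma tc_cong: "x \<in> carrier G \<Longrightarrow> y \<in> carrier G \<Longrightarrow> qF x = qF y \<Longrightarrow> tc x = tc y"
  using tc[of y] by (intro tc_eqI) auto

lemma tc_mult_Fc:
  assumes "x \<in> carrier G" "f \<in> Fc" shows "tc (x \<otimes> f) = tc x"
proof -
  interpret Q: comm_group QF by (rule QF)
  interpret h: group_hom G QF "\<lambda>x. qF x" by (rule QF)
  have f: "f \<in> carrier G" using assms subgroup.mem_carrier[OF Fc_sub] by auto
  have "qF f = \<one>\<^bsub>QF\<^esub>" using f assms(2) rcos_eq_self_iff[OF Fc_sub] by simp
  then have "qF (x \<otimes> f) = qF x"
    using h.hom_mult[OF assms(1) f] Q.r_one[OF h.hom_closed[OF assms(1)]] by argo
  then show ?thesis using assms(1) f by (intro tc_cong) auto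
qed

lemma tc_lt: "x \<in> carrier G \<Longrightarrow> i < n \<Longrightarrow> tc x i < e i"
  using tc(1) by (auto simp: exp_box_def)

text \<open>Addition with wrap-around modulo \<open>e i\<close>. The wrap occurs exactly where the
  cocycle \<open>abdef_delta\<close> contributes its \<open>i\<close>-th factor.\<close>

lemma tc_mult:
  assumes x: "x \<in> carrier G" and y: "y \<in> carrier G"
  shows "tc (x \<otimes> y) = (\<lambda>i. if e i \<le> tc x i + tc y i \<and> i < n then tc x i + tc y i - e i else tc x i + tc y i)"
    (is "_ = ?r")
proof (rule tc_eqI)
  interpret Q: comm_group QF by (rule QF)
  interpret h: group_hom G QF "\<lambda>x. qF x" by (rule QF)
  show "x \<otimes> y \<in> carrier G" using x y by simp
  have b: "\<And>i. i < n \<Longrightarrow> tc x i < e i" "\<And>i. i < n \<Longrightarrow> tc y i < e i"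
      "\<And>i. i \<ge> n \<Longrightarrow> tc x i = 0" "\<And>i. i \<ge> n \<Longrightarrow> tc y i = 0"
    using tc(1)[OF x] tc(1)[OF y] by (auto simp: exp_box_def)
  show "?r \<in> exp_box e n"
    unfolding exp_box_def using b by (auto simp: less_diff_conv2 add_strict_mono)
  have U: "qF (u i) \<in> carrier QF" if "i < n" for i using u_carrier[OF that] by (rule h.hom_closed)
  have "qF (x \<otimes> y) = qF (upow (tc x)) \<otimes>\<^bsub>QF\<^esub> qF (upow (tc y))"
    using h.hom_mult[OF x y] tc(2)[OF x] tc(2)[OF y] by argo
  also have "\<dots> = (\<Otimes>\<^bsub>QF\<^esub>i\<in>{..<n}. qF (u i) [^]\<^bsub>QF\<^esub> tc x i \<otimes>\<^bsub>QF\<^esub> qF (u i) [^]\<^bsub>QF\<^esub> tc y i)"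
    unfolding qF_upow using U by (intro Q.finprod_multf[symmetric]) (auto simp del: mult_FactGroup)
  also have "\<dots> = (\<Otimes>\<^bsub>QF\<^esub>i\<in>{..<n}. qF (u i) [^]\<^bsub>QF\<^esub> ?r i)"
  proof (rule Q.finprod_cong')
    show "(\<lambda>i. qF (u i) [^]\<^bsub>QF\<^esub> ?r i) \<in> {..<n} \<rightarrow> carrier QF" using U by auto
    fix i assume "i \<in> {..<n}"
    then have i: "i < n" by simp
    have *: "qF (u i) [^]\<^bsub>QF\<^esub> tc x i \<otimes>\<^bsub>QF\<^esub> qF (u i) [^]\<^bsub>QF\<^esub> tc y i = qF (u i) [^]\<^bsub>QF\<^esub> (tc x i + tc y i)"
      by (rule Q.nat_pow_mult[OF U[OF i]])
    show "qF (u i) [^]\<^bsub>QF\<^esub> tc x i \<otimes>\<^bsub>QF\<^esub> qF (u i) [^]\<^bsub>QF\<^esub> tc y i = qF (u i) [^]\<^bsub>QF\<^esub> ?r i"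
    proof (cases "e i \<le> tc x i + tc y i")
      case True
      have "qF (u i) [^]\<^bsub>QF\<^esub> (tc x i + tc y i) =
          qF (u i) [^]\<^bsub>QF\<^esub> e i \<otimes>\<^bsub>QF\<^esub> qF (u i) [^]\<^bsub>QF\<^esub> (tc x i + tc y i - e i)"
        using Q.nat_pow_mult[OF U[OF i], of "e i" "tc x i + tc y i - e i"] True by simp
      also have "\<dots> = qF (u i) [^]\<^bsub>QF\<^esub> (tc x i + tc y i - e i)"
        unfolding qF_u_pow[OF i] by (rule Q.l_one) (rule Q.nat_pow_closed[OF U[OF i]])
      finally show ?thesis unfolding * using True i by (simp only: if_True simp_thms)
    next
      case False
      then show ?thesis unfolding * by (simp only: if_False simp_thms)
    qed
  qed simp
  also have "\<dots> = qF (upow ?r)" unfolding qF_upow ..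
  finally show "qF (x \<otimes> y) = qF (upow ?r)" .
qed

section \<open>Integral coordinates on the whole group\<close>

definition E :: nat where "E = (\<Prod>i<n. e i)"

lemma E_pos: "E > 0"
  unfolding E_def using e_gt by (intro prod_pos) force

lemma e_dvd_E: "i < n \<Longrightarrow> e i dvd E"
  unfolding E_def by (intro dvd_prodI) auto

text \<open>G/Fc is generated by the classes of the \<open>u i\<close>, whose orders divide
  \<open>E\<close>.\<close>

lemma pow_E_Fc:
  assumes x: "x \<in> carrier G" shows "x [^] E \<in> Fc"
proof -
  interpret Q: comm_group QF by (rule QF)
  interpret h: group_hom G QF "\<lambda>x. qF x" by (rule QF)
  \<comment> \<open>Taking \<open>E\<close>-th powers is an endomorphism of the abelian quotient, so
    \<open>hom_gprod\<close> distributes it over \<open>upow\<close>.\<close>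
  have c: "group_hom G QF (\<lambda>x. qF x [^]\<^bsub>QF\<^esub> E)"
  proof (intro group_hom.intro group_hom_axioms.intro homI)
    fix a b assume ab: "a \<in> carrier G" "b \<in> carrier G"
    show "qF (a \<otimes> b) [^]\<^bsub>QF\<^esub> E = qF a [^]\<^bsub>QF\<^esub> E \<otimes>\<^bsub>QF\<^esub> qF b [^]\<^bsub>QF\<^esub> E"
      unfolding h.hom_mult[OF ab] by (rule Q.nat_pow_distrib[OF h.hom_closed[OF ab(1)] h.hom_closed[OF ab(2)]])
  qed (use h.hom_closed Q.nat_pow_closed is_group Q.is_group in auto)
  have 1: "qF (u i [^] s) [^]\<^bsub>QF\<^esub> E = \<one>\<^bsub>QF\<^esub>" if i: "i < n" for i and s :: nat
  proof -
    have U: "qF (u i) \<in> carrier QF" using u_carrier[OF i] by (rule h.hom_closed)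
    obtain r where r: "E = e i * r" using e_dvd_E[OF i] by (auto simp: dvd_def)
    have "qF (u i [^] s) [^]\<^bsub>QF\<^esub> E = (qF (u i) [^]\<^bsub>QF\<^esub> e i) [^]\<^bsub>QF\<^esub> (s * r)"
      unfolding h.hom_nat_pow[OF u_carrier[OF i]] r Q.nat_pow_pow[OF U] by (simp only: mult_ac)
    then show ?thesis unfolding qF_u_pow[OF i] Q.nat_pow_one .
  qed
  have "qF (upow (tc x)) [^]\<^bsub>QF\<^esub> E = (\<Otimes>\<^bsub>QF\<^esub>i\<in>{..<n}. qF (u i [^] tc x i) [^]\<^bsub>QF\<^esub> E)"
    unfolding upow_def using u_carrier by (intro hom_gprod[OF QF(1) c]) auto
  also have "\<dots> = \<one>\<^bsub>QF\<^esub>" using 1 by (intro Q.finprod_one_eqI) blast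
  finally have "qF (x [^] E) = \<one>\<^bsub>QF\<^esub>" using tc(2)[OF x] h.hom_nat_pow[OF x, of E] by argo
  then show ?thesis using rcos_eq_self_iff[OF Fc_sub, of "x [^] E"] x by simp
qed

text \<open>\<open>x \<mapsto> lam x\<close> is \<open>E\<close> times the rational extension to \<open>G\<close> of the projection
  \<open>Fc = compl \<times> G0 \<rightarrow> G0\<close>.\<close>

definition lam :: "'a \<Rightarrow> nat \<Rightarrow> int" where
  "lam x = (THE a. vec a \<and> qC (x [^] E) = qC (zpow a))"

lemma lam_eqI:
  assumes "vec a" "qC (x [^] E) = qC (zpow a)" shows "lam x = a"
  unfolding lam_def
proof (rule the_equality)
  fix b assume "vec b \<and> qC (x [^] E) = qC (zpow b)"
  then show "b = a" using assms qC_inj[OF zpow_mem zpow_mem] zpow_inj by metis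
qed (use assms in auto)

lemma lam:
  assumes "x \<in> carrier G"
  shows "vec (lam x)" "qC (x [^] E) = qC (zpow (lam x))"
proof -
  interpret Q: comm_group QC by (rule QC)
  interpret h: group_hom G QC "\<lambda>x. qC x" by (rule QC)
  obtain c g where cg: "c \<in> compl" "g \<in> G0" "x [^] E = c \<otimes> g"
    using Fc_decomp[OF pow_E_Fc[OF assms]] by blast
  obtain a where a: "vec a" "g = zpow a" using ex_zpow[OF cg(2)] by blast
  have c: "c \<in> carrier G" "g \<in> carrier G" using cg G0_carrier subgroup.mem_carrier[OF compl(1)] by auto
  have "qC c = \<one>\<^bsub>QC\<^esub>" using rcos_eq_self_iff[OF compl(1) c(1)] cg(1) by simp
  then have "qC (x [^] E) = qC (zpow a)"
    using cg(3) a(2) h.hom_mult[OF c] Q.l_one[OF h.hom_closed[OF c(2)]] by argo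
  with lam_eqI[OF a(1) this] a(1) show "vec (lam x)" "qC (x [^] E) = qC (zpow (lam x))" by auto
qed

text \<open>Powers do not distribute over products in \<open>G\<close>, but they do modulo
  \<open>compl\<close>, where \<open>lam\<close> is read off.\<close>

lemma lam_mult_fun:
  assumes x: "x \<in> carrier G" and y: "y \<in> carrier G"
  shows "lam (x \<otimes> y) = (\<lambda>k. lam x k + lam y k)"
proof (rule lam_eqI)
  interpret Q: comm_group QC by (rule QC)
  interpret h: group_hom G QC "\<lambda>x. qC x" by (rule QC)
  show "vec (\<lambda>k. lam x k + lam y k)" using lam(1)[OF x] lam(1)[OF y] by (simp add: vec_def)
  have "qC ((x \<otimes> y) [^] E) = qC x [^]\<^bsub>QC\<^esub> E \<otimes>\<^bsub>QC\<^esub> qC y [^]\<^bsub>QC\<^esub> E"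
    unfolding h.hom_nat_pow[OF m_closed[OF x y]] h.hom_mult[OF x y]
    by (rule Q.nat_pow_distrib[OF h.hom_closed[OF x] h.hom_closed[OF y]])
  also have "\<dots> = qC (zpow (lam x)) \<otimes>\<^bsub>QC\<^esub> qC (zpow (lam y))"
    using lam(2)[OF x] lam(2)[OF y] h.hom_nat_pow[OF x, of E] h.hom_nat_pow[OF y, of E] by argo
  also have "\<dots> = qC (zpow (\<lambda>k. lam x k + lam y k))"
    unfolding zpow_add using h.hom_mult[OF zpow_carrier zpow_carrier, of "lam x" "lam y"] by argo
  finally show "qC ((x \<otimes> y) [^] E) = qC (zpow (\<lambda>k. lam x k + lam y k))" .
qed

lemma lam_mult: "x \<in> carrier G \<Longrightarrow> y \<in> carrier G \<Longrightarrow> lam (x \<otimes> y) k = lam x k + lam y k"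
  by (simp add: lam_mult_fun)

lemma lam_compl:
  assumes "x \<in> compl" shows "lam x k = 0"
proof -
  interpret C: subgroup compl G by (rule compl)
  have "x [^] E \<in> compl" using assms subgroup_int_pow_closed[OF compl(1), of x "int E"] by (simp add: int_pow_int)
  then have "qC (x [^] E) = compl" using rcos_eq_self_iff[OF compl(1)] assms by simp
  also have "\<dots> = qC (zpow (\<lambda>k. 0))" unfolding zpow_0 using rcos_eq_self_iff[OF compl(1) one_closed] C.one_closed by metis
  finally have "lam x = (\<lambda>k. 0)" by (intro lam_eqI) (auto simp: vec_def)
  then show ?thesis by simp
qed

lemma lam_zpow:
  assumes "vec a" shows "lam (zpow a) = (\<lambda>k. int E * a k)"
  by (rule lam_eqI) (use assms zpow_mult in \<open>auto simp: vec_def\<close>)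

lemma lam_G0_eq_0:
  assumes g: "g \<in> G0" and 0: "\<And>k. lam g k = 0" shows "g = \<one>"
proof -
  obtain a where a: "vec a" "g = zpow a" using ex_zpow[OF g] by blast
  then have "a = (\<lambda>k. 0)" using 0 lam_zpow[OF a(1)] E_pos by auto
  then show ?thesis using a zpow_0 by simp
qed

lemma lam_z:
  assumes "k < p" shows "lam (z k) j = (if j = k then int E else 0)"
proof -
  have "vec (\<lambda>j. if j = k then 1 else 0)" using assms by (simp add: vec_def)
  then show ?thesis using lam_zpow zpow_unit[OF assms] by simp
qed

text \<open>The factor \<open>y\<close> lies in \<open>compl\<close>, hence
  \<open>e i * lam (u i) = lam (z i)\<close>. The scaling by \<open>E\<close> makes the quotient
  integral.\<close>

lemma lam_u:
  assumes i: "i < n" shows "lam (u i) j = (if j = i then int (E div e i) else 0)"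
proof -
  obtain y where y: "y \<in> isoD" "u i [^] e i = z i \<otimes> y" using u_pow[OF i] by blast
  have ip: "i < p" using i n_le_p by simp
  have c: "z i \<in> carrier G" "y \<in> carrier G" "y \<in> compl"
    using z_in[OF ip] G0_carrier y compl(2) subgroup.mem_carrier[OF compl(1)] by auto
  have "int (e i) * lam (u i) j = lam (z i \<otimes> y) j"
    using additive_nat_pow[of "\<lambda>x. lam x j" "u i" "e i"] lam_mult u_carrier[OF i] y by simp
  also have "\<dots> = (if j = i then int E else 0)"
    using lam_mult c lam_compl lam_z[OF ip] by simp
  also have "\<dots> = int (e i) * (if j = i then int (E div e i) else 0)"
    using e_dvd_E[OF i] by (simp flip: of_nat_mult)
  finally show ?thesis using e_gt[OF i] by simp
qed

lemma lam_Fc: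
  assumes "x \<in> Fc" shows "int E dvd lam x k"
proof -
  obtain h g where hg: "h \<in> compl" "g \<in> G0" "x = h \<otimes> g" using Fc_decomp[OF assms] by blast
  obtain a where a: "vec a" "g = zpow a" using ex_zpow[OF hg(2)] by blast
  have "lam x k = lam g k"
    using hg G0_carrier subgroup.mem_carrier[OF compl(1)] lam_mult lam_compl by simp
  then show ?thesis using lam_zpow[OF a(1)] a by simp
qed

text \<open>\<open>x\<close> and \<open>upow (tc x)\<close> differ by an element of
  \<open>Fc\<close>, whose coordinates are multiples of \<open>E\<close>. Thus the lattice vector
  modulo \<open>E\<close> determines the torsion coordinates: this is the map to the finite
  group.\<close>

lemma lam_mod_E:
  assumes x: "x \<in> carrier G" and k: "k < n"
  shows "int E dvd lam x k - int (tc x k * (E div e k))"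
proof -
  let ?s = "tc x"
  have "x \<otimes> inv upow ?s \<in> Fc" using tc(2)[OF x] rcos_eq_iff[OF Fc_sub x upow_carrier] by blast
  then have "int E dvd lam (x \<otimes> inv upow ?s) k" by (rule lam_Fc)
  moreover have "lam (x \<otimes> inv upow ?s) k = lam x k - lam (upow ?s) k"
    using lam_mult[of x "inv upow ?s" k] additive_inv[of "\<lambda>x. lam x k" "upow ?s"] lam_mult x upow_carrier by simp
  moreover have "lam (upow ?s) k = (\<Sum>i<n. lam (u i [^] ?s i) k)"
    unfolding upow_def using lam_mult u_carrier by (intro additive_gprod) auto
  moreover have "lam (u i [^] ?s i) k = (if i = k then int (?s i * (E div e i)) else 0)" if "i < n" for i
    using additive_nat_pow[of "\<lambda>x. lam x k" "u i" "?s i"] lam_mult u_carrier[OF that] lam_u[OF that] by simp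
  then have "(\<Sum>i<n. lam (u i [^] ?s i) k) = int (?s k * (E div e k))"
    using k by (simp cong: sum.cong_simp)
  ultimately show ?thesis by simp
qed

end

section \<open>Matrices invertible modulo a given integer\<close>

text \<open>Take \<open>a + E * t\<close> with \<open>t\<close> the product of the primes of
  \<open>N\<close> that do not divide \<open>a\<close>. A prime of \<open>N\<close> dividing
  \<open>a\<close> divides neither \<open>E\<close> nor \<open>t\<close>; any other divides
  \<open>t\<close> but not \<open>a\<close>.\<close>

lemma ex_coprime_shift:
  fixes a E N :: int
  assumes "coprime a E" "N \<noteq> 0"
  shows "\<exists>a'. E dvd a' - a \<and> coprime a' N"
proof -
  define t where "t = \<Prod>{q \<in> prime_factors N. \<not> q dvd a}"
  have "coprime (a + E * t) N"
  proof (rule ccontr)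
    assume "\<not> coprime (a + E * t) N"
    then obtain q where q: "Factorial_Ring.prime q" "q dvd a + E * t" "q dvd N"
      using assms(2) prime_divisor_exists[of "gcd (a + E * t) N"] by (auto simp: coprime_iff_gcd_eq_1)
    show False
    proof (cases "q dvd a")
      case True
      then have "q dvd E * t" using q by (simp add: dvd_add_right_iff)
      moreover have "\<not> q dvd E" using assms(1) True q(1) by (meson coprime_common_divisor not_prime_unit)
      ultimately have "q dvd t" using q(1) by (simp add: prime_dvd_mult_iff)
      then obtain r where "r \<in> prime_factors N" "\<not> r dvd a" "q dvd r"
        unfolding t_def using q(1) by (auto simp: prime_dvd_prod_iff)
      then show False using True q(1) by (metis in_prime_factors_imp_prime primes_dvd_imp_eq)
    next
      case False
      then have "q dvd t" using q assms(2) unfolding t_def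
        by (intro dvd_prodI) (auto simp: prime_factors_dvd)
      then have "q dvd a" using q(2) by (metis dvd_add_left_iff dvd_mult)
      then show False using False by simp
    qed
  qed
  then show ?thesis by (intro exI[of _ "a + E * t"]) simp
qed

text \<open>For determinant 1 the adjugate is an integral inverse.\<close>

lemma det_int_1_imp_inverse:
  assumes "det_int n c = 1"
  shows "\<exists>c'. (\<forall>i<n. \<forall>j<n. (\<Sum>l<n. c' i l * c l j) = (if i = j then 1 else 0)) \<and>
              (\<forall>i<n. \<forall>j<n. (\<Sum>l<n. c i l * c' l j) = (if i = j then 1 else 0))"
proof -
  define A where "A = mat n n (\<lambda>(i, j). c i j)"
  have A: "A \<in> carrier_mat n n" by (simp add: A_def)
  have "det A = det_int n c"
  proof -
    have "(\<Prod>i<n. A $$ (i, q i)) = (\<Prod>i<n. c i (q i))" if "q permutes {..<n}" for q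
      using permutes_in_image[OF that] by (intro prod.cong) (auto simp: A_def)
    then show ?thesis by (simp add: det_def'[OF A] det_int_def atLeast0LessThan)
  qed
  then have d: "det A = 1" using assms by simp
  define A' where "A' = adj_mat A"
  note adj = adj_mat[OF A, folded A'_def]
  have A': "A' \<in> carrier_mat n n" using adj by simp
  have prod: "A * A' = 1\<^sub>m n" "A' * A = 1\<^sub>m n" using adj d by auto
  have "(\<Sum>l<n. A' $$ (i, l) * c l j) = (if i = j then 1 else 0)" if "i < n" "j < n" for i j
  proof -
    have "(A' * A) $$ (i, j) = (if i = j then 1 else 0)" using prod that by simp
    then show ?thesis using that A A' by (simp add: scalar_prod_def A_def atLeast0LessThan)
  qed
  moreover have "(\<Sum>l<n. c i l * A' $$ (l, j)) = (if i = j then 1 else 0)" if "i < n" "j < n" for i j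
  proof -
    have "(A * A') $$ (i, j) = (if i = j then 1 else 0)" using prod that by simp
    then show ?thesis using that A A' by (simp add: scalar_prod_def A_def atLeast0LessThan)
  qed
  ultimately show ?thesis by (intro exI[of _ "\<lambda>i j. A' $$ (i, j)"]) blast
qed

text \<open>The row vector \<open>x\<close> times the matrix \<open>c\<close> times the diagonal
  matrix of \<open>d\<close> on the first \<open>n\<close> coordinates, the identity on the
  others.\<close>

definition twist :: "nat \<Rightarrow> (nat \<Rightarrow> int) \<Rightarrow> (nat \<Rightarrow> nat \<Rightarrow> int) \<Rightarrow> (nat \<Rightarrow> int) \<Rightarrow> nat \<Rightarrow> int" where
  "twist n d c x k = (if k < n then d k * (\<Sum>i<n. c i k * x i) else x k)"

lemma twist_lin:
  fixes J :: "nat set"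
  shows "twist n d c (\<lambda>k. \<Sum>v\<in>J. h v * x v k) = (\<lambda>k. \<Sum>v\<in>J. h v * twist n d c (x v) k)"
proof
  fix k
  have "(\<Sum>i<n. c i k * (\<Sum>v\<in>J. h v * x v i)) = (\<Sum>v\<in>J. h v * (\<Sum>i<n. c i k * x v i))"
    unfolding sum_distrib_left by (subst sum.swap) (simp add: mult_ac)
  then show "twist n d c (\<lambda>k. \<Sum>v\<in>J. h v * x v k) k = (\<Sum>v\<in>J. h v * twist n d c (x v) k)"
    by (simp add: twist_def sum_distrib_left mult_ac)
qed

text \<open>The map \<open>T\<close> multiplies by inverses \<open>w j\<close> of the
  \<open>d j\<close> modulo \<open>N\<close> and then by the exact inverse of \<open>c\<close>; only
  the first factor causes an error.\<close>

lemma ex_twist_inverse_mod: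
  fixes N :: int
  assumes det: "det_int n c = 1" and cop: "\<And>k. k < n \<Longrightarrow> coprime (d k) N" 
  obtains T where "\<And>h x. \<And>J::nat set. T (\<lambda>k. \<Sum>v\<in>J. h v * x v k) = (\<lambda>k. \<Sum>v\<in>J. h v * T (x v) k)"
    and "\<And>x k. k \<ge> n \<Longrightarrow> T x k = x k"
    and "\<And>x k. N dvd T (twist n d c x) k - x k" and "\<And>x k. N dvd twist n d c (T x) k - x k"
proof -
  obtain c' where c': "\<And>i j. i < n \<Longrightarrow> j < n \<Longrightarrow> (\<Sum>l<n. c' i l * c l j) = (if i = j then 1 else 0)"
      "\<And>i j. i < n \<Longrightarrow> j < n \<Longrightarrow> (\<Sum>l<n. c i l * c' l j) = (if i = j then 1 else 0)"
    using det_int_1_imp_inverse[OF det] by blast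
  have "\<exists>w. N dvd d k * w - 1" if "k < n" for k
  proof -
    have "coprime (d k) N" using cop that by blast
    then obtain u v where "u * d k + v * N = 1" using bezout_int[of "d k" N] by (auto simp: coprime_iff_gcd_eq_1)
    then have "d k * u - 1 = N * (- v)" by (simp add: algebra_simps)
    then show ?thesis by (metis dvd_triv_left)
  qed
  then obtain w where w: "\<And>k. k < n \<Longrightarrow> N dvd d k * w k - 1" by metis
  define T where "T x k = (if k < n then \<Sum>j<n. c' j k * (w j * x j) else x k)" for x :: "nat \<Rightarrow> int" and k
  have T_lin: "T (\<lambda>k. \<Sum>v\<in>J. h v * x v k) = (\<lambda>k. \<Sum>v\<in>J. h v * T (x v) k)" for h x and J :: "nat set"
  proof
    fix k
    have "(\<Sum>j<n. c' j k * (w j * (\<Sum>v\<in>J. h v * x v j))) = (\<Sum>v\<in>J. h v * (\<Sum>j<n. c' j k * (w j * x v j)))"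
      unfolding sum_distrib_left by (subst sum.swap) (simp add: mult_ac)
    then show "T (\<lambda>k. \<Sum>v\<in>J. h v * x v k) k = (\<Sum>v\<in>J. h v * T (x v) k)"
      by (simp add: T_def)
  qed
  have T1: "N dvd T (twist n d c x) k - x k" for x k
  proof (cases "k < n")
    case True
    have "(\<Sum>j<n. c' j k * (\<Sum>i<n. c i j * x i)) = (\<Sum>i<n. (\<Sum>j<n. c i j * c' j k) * x i)"
      unfolding sum_distrib_left sum_distrib_right by (subst sum.swap) (simp add: mult_ac)
    also have "\<dots> = (\<Sum>i<n. if i = k then x i else 0)" using True c' by (intro sum.cong) auto
    finally have x: "x k = (\<Sum>j<n. c' j k * (\<Sum>i<n. c i j * x i))" using True by simp
    have "T (twist n d c x) k - x k = (\<Sum>j<n. (d j * w j - 1) * (c' j k * (\<Sum>i<n. c i j * x i)))"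
      unfolding x[symmetric] using True
      by (subst x) (simp add: T_def twist_def left_diff_distrib right_diff_distrib sum_subtractf mult_ac)
    then show ?thesis using w by (auto intro!: dvd_sum)
  qed (simp add: T_def twist_def)
  have T2: "N dvd twist n d c (T x) k - x k" for x k
  proof (cases "k < n")
    case True
    have "(\<Sum>i<n. c i k * T x i) = (\<Sum>i<n. c i k * (\<Sum>j<n. c' j i * (w j * x j)))"
      by (intro sum.cong) (auto simp: T_def)
    also have "\<dots> = (\<Sum>j<n. (\<Sum>i<n. c' j i * c i k) * (w j * x j))"
      unfolding sum_distrib_left sum_distrib_right by (subst sum.swap) (simp add: mult_ac)
    also have "\<dots> = (\<Sum>j<n. if j = k then w j * x j else 0)" using True c' by (intro sum.cong) auto
    also have "\<dots> = w k * x k" using True by simp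
    finally have "twist n d c (T x) k - x k = (d k * w k - 1) * x k"
      using True by (simp add: twist_def algebra_simps)
    then show ?thesis using w[OF True] by simp
  qed (simp add: T_def twist_def)
  have "T x k = x k" if "k \<ge> n" for x k using that by (simp add: T_def)
  then show thesis by (rule that[OF T_lin _ T1 T2])
qed

section \<open>The twisted group\<close>

locale abdef_setting = addition_setting +
  fixes d :: "nat \<Rightarrow> int" and c :: "nat \<Rightarrow> nat \<Rightarrow> int"
begin

abbreviation "H \<equiv> Abdef G Fc u e n z d c"
abbreviation "\<delta> \<equiv> abdef_delta G Fc u e n z d c"

lemma carrier_H [simp]: "carrier H = carrier G" and one_H [simp]: "\<one>\<^bsub>H\<^esub> = \<one>"
  and mult_H: "x \<otimes>\<^bsub>H\<^esub> y = x \<otimes> y \<otimes> \<delta> x y"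
  by (simp_all add: Abdef_def)

lemma delta_eq:
  "\<delta> x y = gprod G (\<lambda>i. if e i \<le> tc x i + tc y i
     then gprod G (\<lambda>k. z k [^] (d k * c i k)) n \<otimes> inv z i else \<one>) n"
  by (simp add: abdef_delta_def Let_def)

lemma delta_cong: "tc x = tc x' \<Longrightarrow> tc y = tc y' \<Longrightarrow> \<delta> x y = \<delta> x' y'"
  by (simp add: delta_eq)

lemma z_mem: "i < n \<Longrightarrow> z i \<in> G0"
  using z_in n_le_p by simp

lemma zprod_mem: "gprod G (\<lambda>k. z k [^] (a k :: int)) n \<in> G0"
  using z_mem subgroup_int_pow_closed[OF G0_sub] by (intro gprod_mem[OF G0_sub]) auto

lemma delta_summand_mem:
  "i < n \<Longrightarrow> (if P then gprod G (\<lambda>k. z k [^] (a k :: int)) n \<otimes> inv z i else \<one>) \<in> G0"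
  using zprod_mem z_mem subgroup.m_closed[OF G0_sub] subgroup.m_inv_closed[OF G0_sub]
    subgroup.one_closed[OF G0_sub] by simp

lemma delta_mem: "\<delta> x y \<in> G0"
  unfolding delta_eq by (rule gprod_mem[OF G0_sub delta_summand_mem])

lemma delta_carrier: "\<delta> x y \<in> carrier G"
  using delta_mem G0_carrier by blast

text \<open>Exponents of the factor that a carry at \<open>i\<close> inserts: the product of the
  \<open>z k [^] (d k * c i k)\<close> times \<open>inv z i\<close>.\<close>

definition shift :: "nat \<Rightarrow> nat \<Rightarrow> int" where
  "shift i k = (if k < n then d k * c i k else 0) - (if k = i then 1 else 0)"

lemma lam_delta_summand:
  assumes i: "i < n"
  shows "lam (gprod G (\<lambda>k. z k [^] (d k * c i k)) n \<otimes> inv z i) k = int E * shift i k"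
proof -
  have zc: "z j \<in> carrier G" if "j < n" for j using z_mem[OF that] G0_carrier by blast
  have "lam (gprod G (\<lambda>k. z k [^] (d k * c i k)) n) k = (\<Sum>j<n. lam (z j [^] (d j * c i j)) k)"
    using lam_mult zc by (intro additive_gprod) auto
  also have "\<dots> = (\<Sum>j<n. if j = k then int E * (d k * c i k) else 0)"
  proof (intro sum.cong refl)
    fix j assume "j \<in> {..<n}"
    then have j: "j < n" "j < p" using n_le_p by auto
    show "lam (z j [^] (d j * c i j)) k = (if j = k then int E * (d k * c i k) else 0)"
      using additive_int_pow[of "\<lambda>x. lam x k" "z j" "d j * c i j"] lam_mult zc[OF j(1)] lam_z[OF j(2)] by simp
  qed
  also have "\<dots> = (if k < n then int E * (d k * c i k) else 0)" by simp
  finally have 1: "lam (gprod G (\<lambda>k. z k [^] (d k * c i k)) n) k = (if k < n then int E * (d k * c i k) else 0)" .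
  have "i < p" using i n_le_p by simp
  then have "lam (inv z i) k = - (if k = i then int E else 0)"
    using additive_inv[of "\<lambda>x. lam x k" "z i"] lam_mult zc[OF i] lam_z[of i k] by simp
  then show ?thesis
    using lam_mult[OF G0_carrier[OF zprod_mem] inv_closed[OF zc[OF i]]] 1 by (simp add: shift_def algebra_simps)
qed

lemma lam_one: "lam \<one> k = 0"
  using lam_mult[OF one_closed one_closed, of k] by simp

lemma lam_delta: "lam (\<delta> x y) k = (\<Sum>i<n. if e i \<le> tc x i + tc y i then int E * shift i k else 0)"
proof -
  have "lam (\<delta> x y) k = (\<Sum>i<n. lam (if e i \<le> tc x i + tc y i
      then gprod G (\<lambda>k. z k [^] (d k * c i k)) n \<otimes> inv z i else \<one>) k)"
    unfolding delta_eq using lam_mult G0_carrier[OF delta_summand_mem] by (intro additive_gprod) auto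
  also have "\<dots> = (\<Sum>i<n. if e i \<le> tc x i + tc y i then int E * shift i k else 0)"
    by (intro sum.cong refl) (simp add: lam_delta_summand lam_one)
  finally show ?thesis .
qed

text \<open>In \<open>H\<close> the element \<open>u i\<close> has \<open>e i\<close>-th power \<open>u i [^] e i \<otimes> w i \<otimes> inv z i\<close>, where
  \<open>w i\<close> is the product of the \<open>z k [^] (d k * c i k)\<close>; the correction term makes \<open>lam'\<close> a homomorphism on \<open>H\<close>.\<close>

definition lam' :: "'a \<Rightarrow> nat \<Rightarrow> int" where
  "lam' x k = lam x k + (\<Sum>i<n. int (tc x i * (E div e i)) * shift i k)"

lemma tc_mult_G0: "x \<in> carrier G \<Longrightarrow> g \<in> G0 \<Longrightarrow> tc (x \<otimes> g) = tc x"
  using tc_mult_Fc G0_Fc by blast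

lemma lam'_mult_G0: "x \<in> carrier G \<Longrightarrow> g \<in> G0 \<Longrightarrow> lam' (x \<otimes> g) k = lam' x k + lam g k"
  unfolding lam'_def by (simp add: tc_mult_G0 lam_mult G0_carrier)

text \<open>A carry at \<open>i\<close> lowers the torsion coordinate by \<open>e i\<close>, hence
  the correction term by \<open>e i * (E div e i) = E\<close> times \<open>shift i\<close>; the
  cocycle adds exactly this back.\<close>

lemma lam'_mult:
  assumes x: "x \<in> carrier G" and y: "y \<in> carrier G"
  shows "lam' (x \<otimes>\<^bsub>H\<^esub> y) k = lam' x k + lam' y k"
proof -
  have "lam' (x \<otimes>\<^bsub>H\<^esub> y) k = lam' (x \<otimes> y) k + lam (\<delta> x y) k"
    unfolding mult_H using x y by (intro lam'_mult_G0 delta_mem) auto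
  moreover have "(\<Sum>i<n. int (tc (x \<otimes> y) i * (E div e i)) * shift i k) + lam (\<delta> x y) k =
      (\<Sum>i<n. int (tc x i * (E div e i)) * shift i k) + (\<Sum>i<n. int (tc y i * (E div e i)) * shift i k)"
    unfolding lam_delta sum.distrib[symmetric]
  proof (intro sum.cong refl)
    fix i assume "i \<in> {..<n}"
    then have i: "i < n" by simp
    have E: "int E = int (e i) * int (E div e i)" using e_dvd_E[OF i] by (simp flip: of_nat_mult)
    show "int (tc (x \<otimes> y) i * (E div e i)) * shift i k +
        (if e i \<le> tc x i + tc y i then int E * shift i k else 0) =
        int (tc x i * (E div e i)) * shift i k + int (tc y i * (E div e i)) * shift i k"
    proof (cases "e i \<le> tc x i + tc y i")
      case True
      then have s: "int (tc (x \<otimes> y) i) = int (tc x i) + int (tc y i) - int (e i)"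
        unfolding tc_mult[OF x y] using i by (simp add: of_nat_diff)
      show ?thesis using True unfolding E of_nat_mult s by (simp add: algebra_simps)
    qed (simp add: tc_mult[OF x y] algebra_simps)
  qed
  ultimately show ?thesis unfolding lam'_def using lam_mult[OF x y, of k] by simp
qed

lemma G0_eqI:
  assumes g: "g \<in> G0" "h \<in> G0" and eq: "\<And>k. lam g k = lam h k" shows "g = h"
proof -
  interpret G0: subgroup G0 G by (rule G0_sub)
  have "lam (g \<otimes> inv h) k = 0" for k
    using lam_mult[of g "inv h" k] additive_inv[of "\<lambda>x. lam x k" h] lam_mult g G0_carrier eq by simp
  then have "g \<otimes> inv h = \<one>" using g by (intro lam_G0_eq_0) auto
  then show ?thesis using g G0_carrier inv_solve_right'[of \<one> g h] by auto
qed

text \<open>Coset and coordinates determine an element. In \<open>group_H\<close> this replaces a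
  verification of the cocycle identity.\<close>

lemma coset_eqI:
  assumes "x \<in> carrier G" "g \<in> G0" "h \<in> G0" "\<And>k. lam' (x \<otimes> g) k = lam' (x \<otimes> h) k"
  shows "x \<otimes> g = x \<otimes> h"
proof -
  have "lam g k = lam h k" for k
    using assms(4)[of k] lam'_mult_G0[OF assms(1,2)] lam'_mult_G0[OF assms(1,3)] by simp
  then show ?thesis using G0_eqI[OF assms(2,3)] by simp
qed

lemma tc_one: "tc \<one> = (\<lambda>i. 0)"
proof (rule tc_eqI)
  show "(\<lambda>i. 0) \<in> exp_box e n" using e_gt by (force simp: exp_box_def)
  have "upow (\<lambda>i. 0) \<in> {\<one>}" unfolding upow_def by (rule gprod_mem[OF triv_subgroup]) simp
  then show "qF \<one> = qF (upow (\<lambda>i. 0))" by simp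
qed simp

lemma delta_one: 
  assumes x: "x \<in> carrier G" shows "\<delta> \<one> x = \<one>"
proof -
  have "\<not> e i \<le> tc \<one> i + tc x i" if "i < n" for i
    using tc_lt[OF x that] by (simp add: tc_one)
  then have "\<delta> \<one> x \<in> {\<one>}"
    unfolding delta_eq by (intro gprod_mem[OF triv_subgroup]) auto
  then show ?thesis by simp
qed

lemma group_H: "group H"
proof (rule groupI)
  interpret G0: subgroup G0 G by (rule G0_sub)
  fix x assume "x \<in> carrier H"
  then have x: "x \<in> carrier G" by simp
  show "\<one>\<^bsub>H\<^esub> \<otimes>\<^bsub>H\<^esub> x = x" using x by (simp add: mult_H delta_one)
  show "\<exists>y\<in>carrier H. y \<otimes>\<^bsub>H\<^esub> x = \<one>\<^bsub>H\<^esub>"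
  proof
    \<comment> \<open>The inverse in \<open>G\<close>, corrected by the cocycle value; torsion
      coordinates ignore \<open>G0\<close>, so the correction does not alter that value.\<close>
    let ?g = "inv \<delta> (inv x) x"
    have g: "?g \<in> G0" "?g \<in> carrier G" using delta_mem G0.mem_carrier by blast+
    have "\<delta> (inv x \<otimes> ?g) x = \<delta> (inv x) x" using x g by (intro delta_cong tc_mult_G0) auto
    then have "inv x \<otimes> ?g \<otimes>\<^bsub>H\<^esub> x = inv x \<otimes> (?g \<otimes> x) \<otimes> \<delta> (inv x) x"
      using x g by (simp add: mult_H m_assoc)
    also have "\<dots> = \<one>" unfolding G0_comm[OF g(1) x] using x g(2) delta_carrier by (simp add: m_assoc[symmetric])
    finally show "inv x \<otimes> ?g \<otimes>\<^bsub>H\<^esub> x = \<one>\<^bsub>H\<^esub>" by simp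
    show "inv x \<otimes> ?g \<in> carrier H" using x g by simp
  qed
  fix y assume "y \<in> carrier H"
  then have y: "y \<in> carrier G" by simp
  show "x \<otimes>\<^bsub>H\<^esub> y \<in> carrier H" using x y delta_carrier by (simp add: mult_H)
  fix w assume "w \<in> carrier H"
  then have w: "w \<in> carrier G" by simp
  have xy: "x \<otimes>\<^bsub>H\<^esub> y \<in> carrier G" "y \<otimes>\<^bsub>H\<^esub> w \<in> carrier G" using x y w delta_carrier by (simp_all add: mult_H)
  let ?g = "\<delta> x y \<otimes> \<delta> (x \<otimes>\<^bsub>H\<^esub> y) w" and ?h = "\<delta> y w \<otimes> \<delta> x (y \<otimes>\<^bsub>H\<^esub> w)"
  have "x \<otimes>\<^bsub>H\<^esub> y \<otimes> w = x \<otimes> y \<otimes> (\<delta> x y \<otimes> w)"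
    unfolding mult_H using x y w delta_carrier by (simp add: m_assoc)
  then have "x \<otimes>\<^bsub>H\<^esub> y \<otimes>\<^bsub>H\<^esub> w = x \<otimes> y \<otimes> (\<delta> x y \<otimes> w) \<otimes> \<delta> (x \<otimes>\<^bsub>H\<^esub> y) w"
    using mult_H[of "x \<otimes>\<^bsub>H\<^esub> y" w] by simp
  also have "\<dots> = (x \<otimes> y \<otimes> w) \<otimes> ?g"
    unfolding G0_comm[OF delta_mem w] using x y w delta_carrier by (simp add: m_assoc)
  finally have 1: "x \<otimes>\<^bsub>H\<^esub> y \<otimes>\<^bsub>H\<^esub> w = (x \<otimes> y \<otimes> w) \<otimes> ?g" .
  have 2: "x \<otimes>\<^bsub>H\<^esub> (y \<otimes>\<^bsub>H\<^esub> w) = (x \<otimes> y \<otimes> w) \<otimes> ?h"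
  proof -
    have "x \<otimes> (y \<otimes>\<^bsub>H\<^esub> w) = (x \<otimes> y \<otimes> w) \<otimes> \<delta> y w"
      unfolding mult_H using x y w delta_carrier by (simp add: m_assoc)
    then show ?thesis
      using mult_H[of x "y \<otimes>\<^bsub>H\<^esub> w"] x y w delta_carrier by (simp add: m_assoc)
  qed
  \<comment> \<open>Both bracketings lie in one coset of \<open>G0\<close> and have the same
    coordinates, as \<open>lam'\<close> is additive for the twisted product.\<close>
  have "(x \<otimes> y \<otimes> w) \<otimes> ?g = (x \<otimes> y \<otimes> w) \<otimes> ?h"
  proof (rule coset_eqI)
    fix k
    show "lam' ((x \<otimes> y \<otimes> w) \<otimes> ?g) k = lam' ((x \<otimes> y \<otimes> w) \<otimes> ?h) k"
      unfolding 1[symmetric] 2[symmetric]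
      by (simp add: lam'_mult x y w xy)
  qed (use x y w delta_mem in auto)
  then show "x \<otimes>\<^bsub>H\<^esub> y \<otimes>\<^bsub>H\<^esub> w = x \<otimes>\<^bsub>H\<^esub> (y \<otimes>\<^bsub>H\<^esub> w)" unfolding 1 2 .
qed simp

section \<open>Comparison of the original and the twisted group\<close>

definition same_coset :: "'a \<Rightarrow> 'a \<Rightarrow> bool" where
  "same_coset x y \<longleftrightarrow> (\<exists>g\<in>G0. y = x \<otimes> g)"

text \<open>The cocycle takes values in \<open>G0\<close>, so both multiplications induce the same
  one on cosets of \<open>G0\<close>.\<close>

lemma same_coset_mult:
  assumes x: "x \<in> carrier G" "x' \<in> carrier G" and S: "same_coset x y" "same_coset x' y'"
  shows "same_coset (x \<otimes> x') (y \<otimes>\<^bsub>H\<^esub> y')"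
proof -
  interpret G0: subgroup G0 G by (rule G0_sub)
  obtain g g' where g: "g \<in> G0" "y = x \<otimes> g" "g' \<in> G0" "y' = x' \<otimes> g'"
    using S by (auto simp: same_coset_def)
  have c: "g \<in> carrier G" "g' \<in> carrier G" using g G0_carrier by auto
  have "y \<otimes>\<^bsub>H\<^esub> y' = x \<otimes> (g \<otimes> x') \<otimes> g' \<otimes> \<delta> y y'"
    unfolding mult_H using g x c delta_carrier by (simp add: m_assoc)
  also have "\<dots> = (x \<otimes> x') \<otimes> (g \<otimes> g' \<otimes> \<delta> y y')"
    unfolding G0_comm[OF g(1) x(2)] using x c delta_carrier by (simp add: m_assoc)
  finally show ?thesis using g delta_mem unfolding same_coset_def by blast
qed

lemma same_coset_inv:
  assumes x: "x \<in> carrier G" and S: "same_coset x y"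
  shows "same_coset (inv x) (inv\<^bsub>H\<^esub> y)"
proof -
  interpret G0: subgroup G0 G by (rule G0_sub)
  interpret H: group H by (rule group_H)
  obtain g where g: "g \<in> G0" "y = x \<otimes> g" using S by (auto simp: same_coset_def)
  let ?h = "inv g \<otimes> inv \<delta> y (inv x)"
  have h: "?h \<in> G0" "?h \<in> carrier G" using g delta_mem G0.mem_carrier by blast+
  have c: "g \<in> carrier G" "y \<in> carrier G" using g x G0_carrier by auto
  have "\<delta> y (inv x \<otimes> ?h) = \<delta> y (inv x)" using x h by (intro delta_cong tc_mult_G0) auto
  then have "y \<otimes>\<^bsub>H\<^esub> (inv x \<otimes> ?h) = x \<otimes> (g \<otimes> inv x) \<otimes> ?h \<otimes> \<delta> y (inv x)"
    unfolding mult_H using g x c h delta_carrier by (simp add: m_assoc)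
  also have "\<dots> = \<one>"
    unfolding G0_comm[OF g(1) inv_closed[OF x]]
    using x c h(2) delta_carrier by (simp add: m_assoc[symmetric])
  finally have "inv\<^bsub>H\<^esub> (inv x \<otimes> ?h) = y"
    using H.inv_equality[of y "inv x \<otimes> ?h"] x c h by simp
  then have "inv\<^bsub>H\<^esub> y = inv x \<otimes> ?h" using H.inv_inv[of "inv x \<otimes> ?h"] x h by simp
  then show ?thesis using h unfolding same_coset_def by blast
qed

text \<open>If either element is the identity, the other lies in \<open>G0\<close>, where vanishing
  coordinates force it to be the identity.\<close>

lemma same_coset_one_iff:
  assumes x: "x \<in> carrier G" and S: "same_coset x y" and 0: "\<And>k. lam x k = 0" "\<And>k. lam' y k = 0"
  shows "x = \<one> \<longleftrightarrow> y = \<one>"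
proof -
  interpret G0: subgroup G0 G by (rule G0_sub)
  obtain g where g: "g \<in> G0" "y = x \<otimes> g" using S by (auto simp: same_coset_def)
  have gc: "g \<in> carrier G" using g G0_carrier by auto
  have "lam' \<one> k = 0" for k using lam_one by (simp add: lam'_def tc_one)
  then have "y = \<one>" if "x = \<one>"
    using that g gc 0 lam'_mult_G0[OF x g(1)] by (simp add: lam_G0_eq_0)
  moreover have "x = \<one>" if "y = \<one>"
  proof -
    have "x = inv g" using that g x gc by (metis inv_equality)
    then show ?thesis using g 0 by (intro lam_G0_eq_0) auto
  qed
  ultimately show ?thesis by blast
qed

text \<open>The rows of \<open>shift\<close> form \<open>c\<close> times the diagonal of
  \<open>d\<close>, minus the identity. Modulo \<open>E\<close> the torsion part \<open>s\<close>
  may be exchanged for \<open>lam x\<close>, and \<open>d\<close> for \<open>d'\<close>, which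
  leaves the twist.\<close>

lemma lam'_twist_mod_E:
  assumes x: "x \<in> carrier G" and d': "\<And>k. k < n \<Longrightarrow> int E dvd d' k - d k"
  shows "int E dvd lam' x k - twist n d' c (lam x) k"
proof (cases "k < n")
  case True
  define s where "s i = int (tc x i * (E div e i))" for i
  have s: "int E dvd lam x i - s i" if "i < n" for i using lam_mod_E[OF x that] by (simp add: s_def)
  have "(\<Sum>i<n. s i * shift i k) = (\<Sum>i<n. d k * (c i k * s i) - (if i = k then s i else 0))"
    using True by (intro sum.cong) (auto simp: shift_def algebra_simps)
  also have "\<dots> = d k * (\<Sum>i<n. c i k * s i) - s k"
    using True by (simp add: sum_subtractf sum_distrib_left)
  finally have "lam' x k = lam x k - s k + d k * (\<Sum>i<n. c i k * s i)"
    unfolding lam'_def s_def[symmetric] by simp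
  then have "lam' x k - twist n d' c (lam x) k =
      (lam x k - s k) - (d' k - d k) * (\<Sum>i<n. c i k * s i) - d' k * (\<Sum>i<n. c i k * (lam x i - s i))"
    using True by (simp add: twist_def right_diff_distrib sum_subtractf) (simp add: algebra_simps)
  moreover have "int E dvd (\<Sum>i<n. c i k * (lam x i - s i))" using s by (intro dvd_sum) auto
  ultimately show ?thesis using s[OF True] d'[OF True] by (simp add: dvd_diff)
next
  case False
  have "(\<Sum>i<n. int (tc x i * (E div e i)) * shift i k) = 0"
    using False by (intro sum.neutral) (auto simp: shift_def)
  then show ?thesis using False by (simp add: lam'_def twist_def)
qed

lemma lam_supp: "x \<in> carrier G \<Longrightarrow> k \<ge> p \<Longrightarrow> lam x k = 0"
  using lam(1) by (simp add: vec_def)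

lemma lam'_supp: "x \<in> carrier G \<Longrightarrow> k \<ge> p \<Longrightarrow> lam' x k = 0"
  using n_le_p by (auto simp: lam'_def lam_supp shift_def intro!: sum.neutral)

lemma twist_supp: "(\<And>j. j \<ge> p \<Longrightarrow> x j = 0) \<Longrightarrow> k \<ge> p \<Longrightarrow> twist n d' c x k = 0"
  using n_le_p by (simp add: twist_def)

lemma ex_vec_quotient:
  assumes "\<And>k. k \<ge> p \<Longrightarrow> f k = 0" "\<And>k. int E dvd f k"
  shows "\<exists>b. vec b \<and> f = (\<lambda>k. int E * b k)"
proof (intro exI conjI)
  show "vec (\<lambda>k. f k div int E)" using assms(1) by (simp add: vec_def)
  show "f = (\<lambda>k. int E * (f k div int E))" using assms(2) by simp
qed

lemma approx_lattices_Abdef: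
  assumes N: "int E dvd N0" and d': "\<And>k. k < n \<Longrightarrow> int E dvd d' k - d k"
    and T_lin: "\<And>h x. \<And>J::nat set. T (\<lambda>k. \<Sum>v\<in>J. h v * x v k) = (\<lambda>k. \<Sum>v\<in>J. h v * T (x v) k)"
    and T_supp: "\<And>x k. k \<ge> n \<Longrightarrow> T x k = x k"
    and T1: "\<And>x k. N0 dvd T (twist n d' c x) k - x k" and T2: "\<And>x k. N0 dvd twist n d' c (T x) k - x k"
  shows "approx_lattices G H same_coset lam lam' p (int E) N0 (twist n d' c) T"
proof (intro approx_lattices.intro approx_lattices_axioms.intro is_group group_H)
  interpret G0: subgroup G0 G by (rule G0_sub)
  show "same_coset \<one> \<one>\<^bsub>H\<^esub>" unfolding same_coset_def using G0.one_closed by (intro bexI[of _ \<one>]) auto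
  fix x a assume x: "x \<in> carrier G" and a: "\<And>k. k \<ge> p \<Longrightarrow> a k = 0"
    and cong: "\<And>k. int E dvd a k - twist n d' c (lam x) k"
  \<comment> \<open>Both are congruent to \<open>twist n d' c (lam x)\<close>. The remaining
    multiple of \<open>E\<close> is what a factor \<open>zpow b\<close> from \<open>G0\<close>
    contributes, so \<open>x\<close> is adjusted within its coset.\<close>
  have "int E dvd a k - lam' x k" for k
    using dvd_diff[OF cong[of k] lam'_twist_mod_E[OF x d', of k]] by simp
  then obtain b where b: "vec b" "(\<lambda>k. a k - lam' x k) = (\<lambda>k. int E * b k)"
    using ex_vec_quotient[of "\<lambda>k. a k - lam' x k"] a lam'_supp[OF x] by auto
  have "lam' (x \<otimes> zpow b) k = a k" for k
    using lam'_mult_G0[OF x zpow_mem] lam_zpow[OF b(1)] fun_cong[OF b(2), of k] by simp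
  then show "\<exists>y\<in>carrier H. same_coset x y \<and> lam' y = a"
    using x zpow_mem zpow_carrier unfolding same_coset_def by (intro bexI[of _ "x \<otimes> zpow b"]) auto
next
  interpret G0: subgroup G0 G by (rule G0_sub)
  fix y a assume "y \<in> carrier H" and a: "\<And>k. k \<ge> p \<Longrightarrow> a k = 0"
    and cong: "\<And>k. int E dvd a k - T (lam' y) k"
  then have y: "y \<in> carrier G" by simp
  \<comment> \<open>\<open>E\<close> divides \<open>N0\<close>, so \<open>T\<close> undoes the twist
    modulo \<open>E\<close>, and \<open>a\<close>, \<open>T (lam' y)\<close> and
    \<open>lam y\<close> all agree there.\<close>
  have "int E dvd a k - lam y k" for k
  proof -
    have "int E dvd T (lam' y) k - T (twist n d' c (lam y)) k"
      by (rule lin_dvd_diff[OF T_lin lam'_twist_mod_E[OF y d']])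
    moreover have "int E dvd T (twist n d' c (lam y)) k - lam y k" using T1 N dvd_trans by blast
    ultimately have "int E dvd (a k - T (lam' y) k) + (T (lam' y) k - T (twist n d' c (lam y)) k)
        + (T (twist n d' c (lam y)) k - lam y k)" using cong[of k] by (intro dvd_add)
    then show ?thesis by simp
  qed
  then obtain b where b: "vec b" "(\<lambda>k. a k - lam y k) = (\<lambda>k. int E * b k)"
    using ex_vec_quotient[of "\<lambda>k. a k - lam y k"] a lam_supp[OF y] by auto
  have "lam (y \<otimes> zpow b) k = a k" for k
    using lam_mult[OF y zpow_carrier] lam_zpow[OF b(1)] fun_cong[OF b(2), of k] by simp
  moreover have "y = (y \<otimes> zpow b) \<otimes> inv zpow b" using y zpow_carrier by (simp add: m_assoc)
  then have "same_coset (y \<otimes> zpow b) y" unfolding same_coset_def using zpow_mem by blast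
  ultimately show "\<exists>x\<in>carrier G. same_coset x y \<and> lam x = a"
    using y zpow_carrier by (intro bexI[of _ "y \<otimes> zpow b"]) auto
qed (use n_le_p in \<open>simp_all add: lam_mult lam'_mult lam_supp lam'_supp same_coset_mult same_coset_inv
    same_coset_one_iff twist_lin T_lin T_supp T1 T2 E_pos twist_supp\<close>)

text \<open>\<open>H\<close> is built with \<open>d\<close>, while the game uses the twist with
  \<open>d'\<close>; agreement modulo \<open>E\<close> suffices because coordinates can be adjusted
  by multiples of \<open>E\<close> inside a coset of \<open>G0\<close>.\<close>

theorem elem_equiv_Abdef:
  assumes coprime: "gcd (\<Prod>i<n. d i) (\<Prod>i<n. int (e i)) = 1" and det: "det_int n c = 1"
  shows "elem_equiv H G"
  unfolding elem_equiv_def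
proof (intro allI impI)
  fix f assume f: "fvars f = {}"
  define N where "N = int E * modulus f"
  have N: "N \<noteq> 0" "int E dvd N" using E_pos modulus_pos[of f] by (auto simp: N_def)
  have "\<exists>d'. int E dvd d' - d k \<and> Rings.coprime d' N" if k: "k < n" for k
  proof -
    have "Rings.coprime (\<Prod>i<n. d i) (int E)" using coprime by (simp add: E_def coprime_iff_gcd_eq_1)
    moreover have "d k dvd (\<Prod>i<n. d i)" using k by (intro dvd_prodI) auto
    ultimately have "Rings.coprime (d k) (int E)" using coprime_divisors[OF _ dvd_refl] by blast
    then show ?thesis using N(1) by (rule ex_coprime_shift)
  qed
  then obtain d' where d': "\<And>k. k < n \<Longrightarrow> int E dvd d' k - d k" "\<And>k. k < n \<Longrightarrow> Rings.coprime (d' k) N"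
    by metis
  obtain T where T: "\<And>h x. \<And>J::nat set. T (\<lambda>k. \<Sum>v\<in>J. h v * x v k) = (\<lambda>k. \<Sum>v\<in>J. h v * T (x v) k)"
      "\<And>x k. k \<ge> n \<Longrightarrow> T x k = x k"
      "\<And>x k. N dvd T (twist n d' c x) k - x k" "\<And>x k. N dvd twist n d' c (T x) k - x k"
    by (rule ex_twist_inverse_mod[OF det d'(2)]) (assumption, rule that)
  interpret A: approx_lattices G H same_coset lam lam' p "int E" N "twist n d' c" T
    by (rule approx_lattices_Abdef[OF N(2) d'(1) T])
  show "models H f \<longleftrightarrow> models G f" using A.models_iff_models[OF f N_def] by blast
qed

end

theorem mainTheorem2:
  fixes G :: "('a, 'b) monoid_scheme"
    and G0 Fc :: "'a set"
    and p n :: nat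
    and z u :: "nat \<Rightarrow> 'a"
    and e :: "nat \<Rightarrow> nat"
    and d :: "nat \<Rightarrow> int"
    and c :: "nat \<Rightarrow> nat \<Rightarrow> int"
  assumes grp: "group G"
    and fg: "fin_gen_group G"
    and nil: "nilpotent_group G"
    \<comment> \<open>G0 is an addition of G with basis z_0, ..., z_(p-1)\<close>
    and add: "addition G G0"
    and z_in: "\<forall>k<p. z k \<in> G0"
    and z_basis: "bij_betw (\<lambda>a. gprod G (\<lambda>k. z k [^]\<^bsub>G\<^esub> a k) p)
                    {a :: nat \<Rightarrow> int. \<forall>k\<ge>p. a k = 0} G0"
    and n_le_p: "n \<le> p"
    \<comment> \<open>invariant factor decomposition M(G)/N(G) = direct sum of cyclic groups of orders e_i\<close>
    and u_in: "\<forall>i<n. u i \<in> MG G"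
    and e_gt: "\<forall>i<n. e i > 1"
    and e_dvd: "\<forall>i. Suc i < n \<longrightarrow> e i dvd e (Suc i)"
    and u_dec: "bij_betw (\<lambda>s. NG G #>\<^bsub>G\<^esub> gprod G (\<lambda>i. u i [^]\<^bsub>G\<^esub> s i) n)
                  (exp_box e n) {NG G #>\<^bsub>G\<^esub> m | m. m \<in> MG G}"
    and u_pow: "\<forall>i<n. \<exists>y \<in> isolator G (comm_subgroup G).
                  u i [^]\<^bsub>G\<^esub> e i = z i \<otimes>\<^bsub>G\<^esub> y"
    \<comment> \<open>Fc/N(G) is a complement of M(G)/N(G) in G/N(G)\<close>
    and Fc_sub: "subgroup Fc G"
    and Fc_N: "NG G \<subseteq> Fc"
    and Fc_cap: "Fc \<inter> MG G = NG G"
    and Fc_prod: "Fc <#>\<^bsub>G\<^esub> MG G = carrier G"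
    \<comment> \<open>arithmetic hypotheses\<close>
    and coprime: "gcd (\<Prod>i<n. d i) (\<Prod>i<n. int (e i)) = 1"
    and det1: "det_int n c = 1"
  shows "elem_equiv (Abdef G Fc u e n z d c) G"
proof -
  interpret abdef_setting G G0 Fc p n z u e d c
    by (intro abdef_setting.intro addition_setting.intro addition_setting_axioms.intro)
       (use grp fg add z_in z_basis n_le_p u_in e_gt u_dec u_pow Fc_sub Fc_N Fc_cap Fc_prod in blast)+
  show ?thesis using coprime det1 by (rule elem_equiv_Abdef)
qed

end
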